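(* Let $\mathcal{A}\subset\mathcal{B}(\ell^2(\mathbb{Z}^d))$ be a Banach algebra (of matrices indexed by $\mathbb{Z}^d$) whose norm is translation-invariant and which satisfies the conditions (C1) weak solidity, (C2) weak inverse-closedness and (C3) block norm equivalence (all defined in the context). Then the following are equivalent: (a) $\mathcal{A}$ is inverse-closed in $\mathcal{B}(\ell^2(\mathbb{Z}^d))$. (b) $\mathcal{A}^{FS}$ is inverse-closed. (c) $\mathcal{A}^F$ is inverse-closed in $\mathcal{B}:=\bigoplus_{n=1}^\infty\mathcal{B}(\mathbb{C}^{(2n+1)^d})$.
   Context: Operators on $\ell^2(\mathbb{Z}^d)$ are identified with matrices $A=(a_{kl})_{k,l\in\mathbb{Z}^d}$. We put $\|A\|_{\mathcal{A}}=\infty$ for matrices $A\notin\mathcal{A}$. $\|\cdot\|_{op}$ is the operator norm on $\ell^2$. $C_n=\{-n,\dots,n\}^d$, $(P_ny)(k)=\chi_{C_n}(k)y(k)$, and the finite section $A_n=P_nAP_n$ is regarded as a $(2n+1)^d\times(2n+1)^d$ matrix on $\mathbb{C}^{(2n+1)^d}$; $A_n^{-1}$ means the inverse of this finite matrix. Translation-invariance: with $T_lf(k)=f(k-l)$, $\|T_{-l}AT_l\|_{\mathcal{A}}=\|A\|_{\mathcal{A}}$ for all $A\in\mathcal{A}$, $l\in\mathbb{Z}^d$. Norm of finite matrices: for a $(2n+1)^d\times(2n+1)^d$ matrix $B=(B_{kl})_{k,l\in C_n}$ and $j\in\mathbb{Z}^d$, $J=j+C_n$, let $B^J$ be the infinite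 matrix with $(B^J)_{j+k,j+l}=B_{kl}$ for $k,l\in C_n$ and all other entries $0$; then $\|B\|_{\mathcal{A}}:=\|B^J\|_{\mathcal{A}}$, which does not depend on $j$ by translation-invariance. $\mathcal{A}$ is inverse-closed in $\mathcal{B}(\ell^2(\mathbb{Z}^d))$ if every $A\in\mathcal{A}$ that is invertible on $\ell^2(\mathbb{Z}^d)$ satisfies $A^{-1}\in\mathcal{A}$. $\mathcal{A}^{FS}=\{(A_n)_{n\in\mathbb{N}}:A_n=P_nAP_n\text{ for some }A\in\mathcal{A}\}$. $\mathcal{A}^{FS}$ is inverse-closed if for every sequence $(A_n)_{n\in\mathbb{N}}\in\mathcal{A}^{FS}$ of invertible finite sections with $\|A_n\|_{\mathcal{A}}\le C$ and $\|A_n^{-1}\|_{op}\le C$ for all $n$, one has $\|A_n^{-1}\|_{\mathcal{A}}\le C'$ for all $n$, with constants $C,C'$ not depending on $n$. $\mathcal{A}^F$ is the set of sequences $\vec B=(B_n)_{n\in\mathbb{N}}$ where $B_n$ is a $(2n+1)^d\times(2n+1)^d$ matrix and $\sup_n\|B_n\|_{\mathcal{A}}<\infty$. $\mathcal{A}^F$ is inverse-closed (in $\bigoplus_{n}\mathcal{B}(\mathbb{C}^{(2n+1)^d})$) if for every such sequence of invertible matrices with $\|B_n\|_{\mathcal{A}}\le C$ and $\|B_n^{-1}\|_{op}\le C$ for all $n$, one has $\|B_n^{-1}\|_{\mathcal{A}}\le C'$ for all $n$, with constants $C,C'$ not depending on $n$. (C1) Weak solidity: for every $A\in\mathcal{A}$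 there is a constant $C$ such that $\|A_n\|_{\mathcal{A}}\le C\|A\|_{\mathcal{A}}$ for all $n\in\mathbb{N}$. (C2) Weak inverse-closedness: for every $A\in\mathcal{A}$ that is invertible on $\ell^2(\mathbb{Z}^d)$, the condition $\sup_{n\in\mathbb{N}}\|A_n^{-1}\|_{\mathcal{A}}\le C$ (the $A_n$ being invertible) implies $A^{-1}\in\mathcal{A}$. (C3) Block norm equivalence: choose a sequence $j_m\in\mathbb{Z}^d$, $m\in\mathbb{N}$, such that the cubes $J_m=j_m+C_m$ are pairwise disjoint, and for $\vec B=(B_m)_{m\in\mathbb{N}}$ set $B^{block}=\sum_{m\in\mathbb{N}}B_m^{J_m}$. There exist constants $C,C'>0$ such that for every $\vec B\in\mathcal{A}^F$, $C\|B^{block}\|_{\mathcal{A}}\le\sup_{m}\|B_m\|_{\mathcal{A}}\le C'\|B^{block}\|_{\mathcal{A}}$.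
   Formalization: The Banach algebra is assumed to contain the identity and to be closed under adjoints; without adjoints the claim fails (bounded lower triangular matrices on ℓ²(ℤ): (b), (c) hold, but the shift's inverse is not lower triangular), and without the identity (a) can be vacuous while (c) fails. *)

theory Defs
  imports "HOL-Analysis.Analysis"
begin

type_synonym 'd zvec = "(int ^ 'd) \<Rightarrow> complex"
type_synonym 'd zmat = "(int ^ 'd) \<Rightarrow> (int ^ 'd) \<Rightarrow> complex"

section \<open>Operators on square-summable sequences as matrices\<close>

definition ell2 :: "('d::finite) zvec set" where
  "ell2 = {f. (\<lambda>k. (norm (f k))\<^sup>2) summable_on UNIV}"

definition ell2_norm :: "('d::finite) zvec \<Rightarrow> real" where
  "ell2_norm f = sqrt (\<Sum>\<^sub>\<infinity>k. (norm (f k))\<^sup>2)"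

definition mat_apply :: "('d::finite) zmat \<Rightarrow> 'd zvec \<Rightarrow> 'd zvec" where
  "mat_apply A f = (\<lambda>k. \<Sum>\<^sub>\<infinity>l. A k l * f l)"

definition mat_mult :: "('d::finite) zmat \<Rightarrow> 'd zmat \<Rightarrow> 'd zmat" where
  "mat_mult A B = (\<lambda>k l. \<Sum>\<^sub>\<infinity>m. A k m * B m l)"

definition mat_add :: "('d::finite) zmat \<Rightarrow> 'd zmat \<Rightarrow> 'd zmat" where
  "mat_add A B = (\<lambda>k l. A k l + B k l)"

definition mat_diff :: "('d::finite) zmat \<Rightarrow> 'd zmat \<Rightarrow> 'd zmat" where
  "mat_diff A B = (\<lambda>k l. A k l - B k l)"

definition mat_scale :: "complex \<Rightarrow> ('d::finite) zmat \<Rightarrow> 'd zmat" where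
  "mat_scale c A = (\<lambda>k l. c * A k l)"

definition mat_zero :: "('d::finite) zmat" where
  "mat_zero = (\<lambda>k l. 0)"

definition mat_id :: "('d::finite) zmat" where
  "mat_id = (\<lambda>k l. if k = l then 1 else 0)"

definition mat_adjoint :: "('d::finite) zmat \<Rightarrow> 'd zmat" where
  "mat_adjoint A = (\<lambda>k l. cnj (A l k))"

text \<open>A bounded operator \<open>T\<close> is identified with its matrix \<open>a k l = \<langle>T e\<^sub>l, e\<^sub>k\<rangle>\<close>. The rows of such a
  matrix are square-summable, so every series below converges absolutely; conversely, every matrix
  in the following set defines a bounded operator. The summability clause is needed because
  \<open>infsum\<close> is 0 on families that are not summable.\<close>

definition bounded_mats :: "('d::finite) zmat set" where
  "bounded_mats = {A. (\<forall>f\<in>ell2. \<forall>k. (\<lambda>l. A k l * f l) summable_on UNIV) \<and>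
     (\<exists>C. \<forall>f\<in>ell2. mat_apply A f \<in> ell2 \<and> ell2_norm (mat_apply A f) \<le> C * ell2_norm f)}"

text \<open>Meaningful on \<^const>\<open>bounded_mats\<close>, in particular on matrices with finitely many nonzero
  entries. For a zero-extended finite matrix it is the operator norm of the finite matrix.\<close>

definition op_norm :: "('d::finite) zmat \<Rightarrow> real" where
  "op_norm A = (SUP f\<in>{f \<in> ell2. ell2_norm f \<le> 1}. ell2_norm (mat_apply A f))"

definition is_l2_inverse :: "('d::finite) zmat \<Rightarrow> 'd zmat \<Rightarrow> bool" where
  "is_l2_inverse A X \<longleftrightarrow> X \<in> bounded_mats \<and> mat_mult A X = mat_id \<and> mat_mult X A = mat_id"

section \<open>Banach algebras of matrices\<close>

text \<open>The algebra is unital, with the identity of the ambient algebra of bounded operators; this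
  is the usual convention when inverse-closedness is discussed. Neither a normalised unit nor
  continuity of the inclusion into the bounded operators is required.\<close>

locale matrix_banach_algebra =
  fixes \<A> :: "('d::finite) zmat set" and nrm :: "'d zmat \<Rightarrow> real"
  assumes bounded: "\<A> \<subseteq> bounded_mats"
    and zero_closed: "mat_zero \<in> \<A>"
    and id_closed: "mat_id \<in> \<A>"
    and add_closed: "\<And>A B. A \<in> \<A> \<Longrightarrow> B \<in> \<A> \<Longrightarrow> mat_add A B \<in> \<A>"
    and scale_closed: "\<And>c A. A \<in> \<A> \<Longrightarrow> mat_scale c A \<in> \<A>"
    and mult_closed: "\<And>A B. A \<in> \<A> \<Longrightarrow> B \<in> \<A> \<Longrightarrow> mat_mult A B \<in> \<A>"
    and nrm_nonneg: "\<And>A. A \<in> \<A> \<Longrightarrow> 0 \<le> nrm A"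
    and nrm_eq_0: "\<And>A. A \<in> \<A> \<Longrightarrow> nrm A = 0 \<longleftrightarrow> A = mat_zero"
    and nrm_add: "\<And>A B. A \<in> \<A> \<Longrightarrow> B \<in> \<A> \<Longrightarrow> nrm (mat_add A B) \<le> nrm A + nrm B"
    and nrm_scale: "\<And>c A. A \<in> \<A> \<Longrightarrow> nrm (mat_scale c A) = norm c * nrm A"
    and nrm_mult: "\<And>A B. A \<in> \<A> \<Longrightarrow> B \<in> \<A> \<Longrightarrow> nrm (mat_mult A B) \<le> nrm A * nrm B"
    and complete: "Metric_space.mcomplete \<A> (\<lambda>A B. nrm (mat_diff A B))"

text \<open>The standing involution of the theory: \<open>\<A>\<close> is closed under adjoints (the involution need not
  be isometric). For algebras that are not closed under adjoints, finite sections do not detect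
  invertibility: the bounded lower triangular matrices on \<open>\<int>\<close> with the operator norm satisfy all
  conditions below, and finite inverses stay in the algebra with the same norm, but the bilateral
  shift has an upper triangular inverse.\<close>

definition star_closed :: "('d::finite) zmat set \<Rightarrow> bool" where
  "star_closed \<A> \<longleftrightarrow> (\<forall>A\<in>\<A>. mat_adjoint A \<in> \<A>)"

definition ext_norm :: "('d::finite) zmat set \<Rightarrow> ('d zmat \<Rightarrow> real) \<Rightarrow> 'd zmat \<Rightarrow> ennreal" where
  "ext_norm \<A> nrm A = (if A \<in> \<A> then ennreal (nrm A) else \<infinity>)"

text \<open>The matrix of \<open>(T\<^sub>l f) k = f (k - l)\<close>.\<close>

definition translation :: "int ^ 'd \<Rightarrow> ('d::finite) zmat" where
  "translation l = (\<lambda>k m. if m = k - l then 1 else 0)"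

definition translation_invariant ::
    "('d::finite) zmat set \<Rightarrow> ('d zmat \<Rightarrow> real) \<Rightarrow> bool" where
  "translation_invariant \<A> nrm \<longleftrightarrow>
     (\<forall>A\<in>\<A>. \<forall>l. ext_norm \<A> nrm (mat_mult (mat_mult (translation (- l)) A) (translation l))
                  = ext_norm \<A> nrm A)"

definition inverse_closed :: "('d::finite) zmat set \<Rightarrow> bool" where
  "inverse_closed \<A> \<longleftrightarrow> (\<forall>A\<in>\<A>. \<forall>X. is_l2_inverse A X \<longrightarrow> X \<in> \<A>)"

section \<open>Finite matrices and finite sections\<close>

definition cube :: "nat \<Rightarrow> (int ^ 'd::finite) set" where
  "cube n = {k. \<forall>i. \<bar>k $ i\<bar> \<le> int n}"

definition cube_proj :: "nat \<Rightarrow> ('d::finite) zmat" where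
  "cube_proj n = (\<lambda>k l. if k = l \<and> k \<in> cube n then 1 else 0)"

text \<open>A \<open>(2n+1)\<^sup>d \<times> (2n+1)\<^sup>d\<close> matrix is represented by its extension by zero from
  \<open>cube n \<times> cube n\<close> to an infinite matrix, that is, by \<^term>\<open>embed n 0 B\<close> below. Under
  translation-invariance the norm of \<^term>\<open>embed n j B\<close> does not depend on \<open>j\<close>, so the algebra
  norm of a finite matrix is \<^const>\<open>ext_norm\<close> of its representative.\<close>

definition fin_mat :: "nat \<Rightarrow> ('d::finite) zmat \<Rightarrow> bool" where
  "fin_mat n B \<longleftrightarrow> (\<forall>k l. k \<notin> cube n \<or> l \<notin> cube n \<longrightarrow> B k l = 0)"

definition embed :: "nat \<Rightarrow> int ^ 'd \<Rightarrow> ('d::finite) zmat \<Rightarrow> 'd zmat" where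
  "embed n j B =
     (\<lambda>k l. if k - j \<in> cube n \<and> l - j \<in> cube n then B (k - j) (l - j) else 0)"

definition is_fin_inverse :: "nat \<Rightarrow> ('d::finite) zmat \<Rightarrow> 'd zmat \<Rightarrow> bool" where
  "is_fin_inverse n B X \<longleftrightarrow>
     fin_mat n X \<and> mat_mult B X = cube_proj n \<and> mat_mult X B = cube_proj n"

definition finite_section :: "nat \<Rightarrow> ('d::finite) zmat \<Rightarrow> 'd zmat" where
  "finite_section n A = mat_mult (mat_mult (cube_proj n) A) (cube_proj n)"

text \<open>Sequences are indexed by \<open>n \<ge> 1\<close>; their value at 0 is never used.\<close>

definition section_seqs :: "('d::finite) zmat set \<Rightarrow> (nat \<Rightarrow> 'd zmat) set" where
  "section_seqs \<A> = {S. \<exists>A\<in>\<A>. \<forall>n\<ge>1. S n = finite_section n A}"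

definition finite_mat_seqs ::
    "('d::finite) zmat set \<Rightarrow> ('d zmat \<Rightarrow> real) \<Rightarrow> (nat \<Rightarrow> 'd zmat) set" where
  "finite_mat_seqs \<A> nrm =
     {B. (\<forall>n\<ge>1. fin_mat n (B n)) \<and> (SUP n\<in>{1..}. ext_norm \<A> nrm (B n)) < \<infinity>}"

definition seqs_inverse_closed ::
    "('d::finite) zmat set \<Rightarrow> ('d zmat \<Rightarrow> real) \<Rightarrow> (nat \<Rightarrow> 'd zmat) set \<Rightarrow> bool" where
  "seqs_inverse_closed \<A> nrm \<S> \<longleftrightarrow>
     (\<forall>B\<in>\<S>. \<forall>X. \<forall>C::real.
        (\<forall>n\<ge>1. is_fin_inverse n (B n) (X n) \<and>
               ext_norm \<A> nrm (B n) \<le> ennreal C \<and> op_norm (X n) \<le> C) \<longrightarrow>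
        (\<exists>C'::real. \<forall>n\<ge>1. ext_norm \<A> nrm (X n) \<le> ennreal C'))"

section \<open>The three conditions on the algebra\<close>

definition weakly_solid :: "('d::finite) zmat set \<Rightarrow> ('d zmat \<Rightarrow> real) \<Rightarrow> bool" where
  "weakly_solid \<A> nrm \<longleftrightarrow>
     (\<forall>A\<in>\<A>. \<exists>C::real. \<forall>n\<ge>1.
        ext_norm \<A> nrm (finite_section n A) \<le> ennreal C * ext_norm \<A> nrm A)"

definition weakly_inverse_closed :: "('d::finite) zmat set \<Rightarrow> ('d zmat \<Rightarrow> real) \<Rightarrow> bool" where
  "weakly_inverse_closed \<A> nrm \<longleftrightarrow>
     (\<forall>A\<in>\<A>. \<forall>X. is_l2_inverse A X \<longrightarrow>
        (\<forall>Y. \<forall>C::real.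
           (\<forall>n\<ge>1. is_fin_inverse n (finite_section n A) (Y n)) \<and>
           (SUP n\<in>{1..}. ext_norm \<A> nrm (Y n)) \<le> ennreal C \<longrightarrow> X \<in> \<A>))"

definition disjoint_cubes :: "(nat \<Rightarrow> int ^ 'd::finite) \<Rightarrow> bool" where
  "disjoint_cubes j \<longleftrightarrow> disjoint_family_on (\<lambda>m. (\<lambda>k. j m + k) ` cube m) {1..}"

text \<open>For disjoint cubes at most one term of each entrywise sum is nonzero.\<close>

definition block_mat :: "(nat \<Rightarrow> int ^ 'd) \<Rightarrow> (nat \<Rightarrow> ('d::finite) zmat) \<Rightarrow> 'd zmat" where
  "block_mat j B = (\<lambda>k l. \<Sum>\<^sub>\<infinity>m\<in>{1..}. embed m (j m) (B m) k l)"

definition block_norm_equivalence ::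
    "('d::finite) zmat set \<Rightarrow> ('d zmat \<Rightarrow> real) \<Rightarrow> (nat \<Rightarrow> int ^ 'd) \<Rightarrow> bool" where
  "block_norm_equivalence \<A> nrm j \<longleftrightarrow>
     (\<exists>C C'::real. C > 0 \<and> C' > 0 \<and> (\<forall>B\<in>finite_mat_seqs \<A> nrm.
        ennreal C * ext_norm \<A> nrm (block_mat j B) \<le> (SUP m\<in>{1..}. ext_norm \<A> nrm (B m)) \<and>
        (SUP m\<in>{1..}. ext_norm \<A> nrm (B m)) \<le> ennreal C' * ext_norm \<A> nrm (block_mat j B)))"

end

theory Submission
  imports Defs "HOL-Library.Function_Algebras"
begin

text \<open>(a) implies (c): glue a sequence \<open>B\<close> into one block-diagonal matrix, completed by the identity
  outside the cubes. It lies in the algebra by (C3), its inverse is the gluing of the finite inverses,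
  and cutting out a block costs at most a factor \<open>sup\<^sub>m \<parallel>P\<^sub>m\<parallel>\<close>, which (C1) bounds when applied to the
  identity. (c) implies (b) because sections of bounded norm are a particular sequence.
  (b) implies (a): the sections of \<open>T = A\<^sup>* A\<close> are uniformly bounded below, hence invertible with
  uniformly bounded inverses, so (b) and (C2) put \<open>T\<^sup>-\<^sup>1\<close> into the algebra, and
  \<open>A\<^sup>-\<^sup>1 = T\<^sup>-\<^sup>1 A\<^sup>*\<close>.\<close>

section \<open>Square-summable sequences\<close>

text \<open>The sections of an invertible \<open>A\<close> can be singular: in dimension one those
  of the bilateral shift are nilpotent. Passing to the positive operator \<open>A^* A\<close>
  removes this obstacle, since compressing it to a cube keeps its lower bound, and closure of the
  algebra under adjoints makes the passage possible. In the gluing direction, the inequality of (C3)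
  that bounds the blocks by the block matrix cannot be applied to the inverses: (C3) speaks only of
  sequences with finite supremum, and for the inverses that is the claim. Hence the detour through
  projections onto single cubes. The completion by the identity is there because the cubes may leave
  gaps, where the bare block matrix vanishes and cannot be inverted. Underneath lies an analytic
  obstacle: products are entrywise \<open>infsum\<close>s, and the double series behind
  associativity need not converge absolutely, so sums are interchanged for finite truncations only,
  followed by a limit.\<close>

definition trunc :: "('d::finite) zvec \<Rightarrow> (int ^ 'd) set \<Rightarrow> 'd zvec" where
  "trunc f F = (\<lambda>k. if k \<in> F then f k else 0)"

text \<open>Without conjugation the pairing stays bilinear, so sums are interchanged for the
  transpose first; the adjoint is then obtained by conjugating input and output.\<close>

definition mat_transpose :: "('d::finite) zmat \<Rightarrow> 'd zmat" where
  "mat_transpose A = (\<lambda>k l. A l k)"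

lemma infsum_finite_support:
  fixes f :: "'a \<Rightarrow> complex"
  assumes "finite F" and "\<And>x. x \<notin> F \<Longrightarrow> f x = 0"
  shows "f summable_on UNIV" and "infsum f UNIV = sum f F"
proof -
  have "f summable_on F" using assms(1) by simp
  then show "f summable_on UNIV"
    by (rule summable_on_cong_neutral[THEN iffD1, rotated -1]) (use assms in auto)
  have "infsum f UNIV = infsum f F"
    by (rule infsum_cong_neutral) (use assms in auto)
  then show "infsum f UNIV = sum f F" using assms(1) by simp
qed

lemma infsum_finite_sum:
  fixes f :: "'i \<Rightarrow> 'a \<Rightarrow> complex"
  assumes "finite F" and "\<And>i. i \<in> F \<Longrightarrow> f i summable_on A"
  shows "(\<Sum>i\<in>F. infsum (f i) A) = (\<Sum>\<^sub>\<infinity>k\<in>A. \<Sum>i\<in>F. f i k)"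
proof -
  have "((\<lambda>k. \<Sum>i\<in>F. f i k) has_sum (\<Sum>i\<in>F. infsum (f i) A)) A"
    using assms
  proof (induction F rule: finite_induct)
    case (insert i F)
    then have "((\<lambda>k. f i k + (\<Sum>i\<in>F. f i k)) has_sum (infsum (f i) A + (\<Sum>i\<in>F. infsum (f i) A))) A"
      by (intro has_sum_add has_sum_infsum) auto
    then show ?case using insert.hyps by simp
  qed simp
  then show ?thesis by (simp add: infsumI)
qed

lemma infsum_of_real: "(\<Sum>\<^sub>\<infinity>x\<in>A. complex_of_real (f x)) = complex_of_real (infsum f A)"
proof (cases "f summable_on A")
  case True
  then show ?thesis by (intro infsumI has_sum_of_real has_sum_infsum)
next
  case False
  moreover have "\<not> (\<lambda>x. complex_of_real (f x)) summable_on A"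
    using False summable_on_Re by fastforce
  ultimately show ?thesis by (simp add: infsum_not_exists)
qed

lemma ell2_norm_nonneg: "0 \<le> ell2_norm f"
  unfolding ell2_norm_def by (intro real_sqrt_ge_zero infsum_nonneg) auto

lemma ell2_norm_power2: "(ell2_norm f)\<^sup>2 = (\<Sum>\<^sub>\<infinity>k. (norm (f k))\<^sup>2)"
  unfolding ell2_norm_def by (intro real_sqrt_pow2 infsum_nonneg) auto

lemma L2_set_le_ell2_norm:
  assumes "f \<in> ell2" "finite F"
  shows "L2_set (\<lambda>k. norm (f k)) F \<le> ell2_norm f"
  unfolding L2_set_def ell2_norm_def
  by (intro real_sqrt_le_mono finite_sum_le_infsum) (use assms in \<open>auto simp: ell2_def\<close>)

text \<open>\<open>infsum\<close> is 0 on non-summable families, so a bound on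
  \<open>ell2_norm\<close> alone says nothing; a uniform bound on finite partial norms yields
  membership and estimate together.\<close>

lemma
  assumes "\<And>F. finite F \<Longrightarrow> L2_set (\<lambda>k. norm (f k)) F \<le> c"
  shows ell2I: "f \<in> ell2" and ell2_norm_le: "ell2_norm f \<le> c"
proof -
  have c: "0 \<le> c" using assms[of "{}"] by simp
  have le: "(\<Sum>k\<in>F. (norm (f k))\<^sup>2) \<le> c\<^sup>2" if "finite F" for F
    using assms[OF that] c unfolding L2_set_def by (simp add: real_sqrt_le_iff' sqrt_le_D)
  show f: "f \<in> ell2"
    unfolding ell2_def mem_Collect_eq
    by (rule nonneg_bdd_above_summable_on) (auto intro!: bdd_aboveI[of _ "c\<^sup>2"] le)
  have "(ell2_norm f)\<^sup>2 \<le> c\<^sup>2"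
    unfolding ell2_norm_power2
    by (rule infsum_le_finite_sums) (use f le in \<open>auto simp: ell2_def\<close>)
  then show "ell2_norm f \<le> c" using c by (rule power2_le_imp_le)
qed

lemma
  assumes "f \<in> ell2" "\<And>k. norm (g k) \<le> norm (f k)"
  shows ell2_mono: "g \<in> ell2" and ell2_norm_mono: "ell2_norm g \<le> ell2_norm f"
proof -
  have *: "L2_set (\<lambda>k. norm (g k)) F \<le> ell2_norm f" if "finite F" for F
    using order_trans[OF L2_set_mono L2_set_le_ell2_norm[OF assms(1) that]] assms(2) by auto
  show "g \<in> ell2" by (rule ell2I[OF *])
  show "ell2_norm g \<le> ell2_norm f" by (rule ell2_norm_le[OF *])
qed

lemma ell2_norm_eq_0:
  assumes "f \<in> ell2" "ell2_norm f \<le> 0"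
  shows "f k = 0"
proof -
  have "norm (f k) \<le> ell2_norm f"
    using L2_set_le_ell2_norm[OF assms(1), of "{k}"] by simp
  with assms(2) have "norm (f k) \<le> 0" by linarith
  then show ?thesis by simp
qed

lemma ell2_trunc: "f \<in> ell2 \<Longrightarrow> trunc f F \<in> ell2"
  by (erule ell2_mono) (simp add: trunc_def)

lemma ell2_norm_trunc_le: "f \<in> ell2 \<Longrightarrow> ell2_norm (trunc f F) \<le> ell2_norm f"
  by (erule ell2_norm_mono) (simp add: trunc_def)

lemma
  assumes "finite F"
  shows ell2_trunc_finite: "trunc f F \<in> ell2"
    and ell2_norm_trunc: "ell2_norm (trunc f F) = L2_set (\<lambda>k. norm (f k)) F"
proof -
  have eq: "L2_set (\<lambda>k. norm (trunc f F k)) G = L2_set (\<lambda>k. norm (f k)) (G \<inter> F)" if "finite G" for G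
    unfolding L2_set_def trunc_def sum.inter_restrict[OF that]
    by (rule arg_cong[of _ _ sqrt], rule sum.cong) auto
  have *: "L2_set (\<lambda>k. norm (trunc f F k)) G \<le> L2_set (\<lambda>k. norm (f k)) F" if "finite G" for G
    unfolding eq[OF that] unfolding L2_set_def
    by (rule real_sqrt_le_mono, rule sum_mono2) (use assms in auto)
  show m: "trunc f F \<in> ell2" by (rule ell2I[OF *])
  show "ell2_norm (trunc f F) = L2_set (\<lambda>k. norm (f k)) F"
    using ell2_norm_le[OF *] L2_set_le_ell2_norm[OF m assms] eq[OF assms] by simp
qed

lemma
  assumes "f \<in> ell2" "g \<in> ell2"
  shows ell2_summable_mult: "(\<lambda>k. f k * g k) summable_on UNIV"
    and ell2_Cauchy_Schwarz: "norm (\<Sum>\<^sub>\<infinity>k. f k * g k) \<le> ell2_norm f * ell2_norm g"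
proof -
  have le: "(\<Sum>k\<in>F. norm (f k * g k)) \<le> ell2_norm f * ell2_norm g" if "finite F" for F
  proof -
    have "(\<Sum>k\<in>F. norm (f k * g k)) \<le> L2_set (\<lambda>k. norm (f k)) F * L2_set (\<lambda>k. norm (g k)) F"
      using L2_set_mult_ineq[of "\<lambda>k. norm (f k)" "\<lambda>k. norm (g k)" F] by (simp add: norm_mult)
    also have "\<dots> \<le> ell2_norm f * ell2_norm g"
      by (intro mult_mono L2_set_le_ell2_norm assms that ell2_norm_nonneg L2_set_nonneg)
    finally show ?thesis .
  qed
  have s: "(\<lambda>k. norm (f k * g k)) summable_on UNIV"
    by (rule nonneg_bdd_above_summable_on)
       (auto intro!: bdd_aboveI[of _ "ell2_norm f * ell2_norm g"] le)
  then show "(\<lambda>k. f k * g k) summable_on UNIV" by (rule abs_summable_summable)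
  have "norm (\<Sum>\<^sub>\<infinity>k. f k * g k) \<le> (\<Sum>\<^sub>\<infinity>k. norm (f k * g k))"
    by (rule norm_infsum_bound[OF s])
  also have "\<dots> \<le> ell2_norm f * ell2_norm g"
    by (rule infsum_le_finite_sums[OF s le])
  finally show "norm (\<Sum>\<^sub>\<infinity>k. f k * g k) \<le> ell2_norm f * ell2_norm g" .
qed

text \<open>The square of the tail norm is the total sum minus a finite partial sum. This limit
  carries the interchange of sums in \<open>infsum_transpose\<close>.\<close>

lemma tail_tendsto_0:
  assumes "f \<in> ell2"
  shows "((\<lambda>F. ell2_norm (trunc f (- F))) \<longlongrightarrow> 0) (finite_subsets_at_top UNIV)"
proof -
  let ?g = "\<lambda>k. (norm (f k))\<^sup>2"
  have s: "?g summable_on UNIV" using assms by (simp add: ell2_def)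
  have "((\<lambda>F. sqrt (infsum ?g UNIV - sum ?g F)) \<longlongrightarrow> sqrt (infsum ?g UNIV - infsum ?g UNIV))
      (finite_subsets_at_top UNIV)"
    by (intro tendsto_intros infsum_tendsto s)
  then have lim: "((\<lambda>F. sqrt (infsum ?g UNIV - sum ?g F)) \<longlongrightarrow> 0) (finite_subsets_at_top UNIV)"
    by simp
  have eq: "ell2_norm (trunc f (- F)) = sqrt (infsum ?g UNIV - sum ?g F)" if "finite F" for F
  proof -
    have "infsum ?g UNIV = infsum ?g (F \<union> - F)" by simp
    also have "\<dots> = infsum ?g F + infsum ?g (- F)"
      by (rule infsum_Un_disjoint) (use s that summable_on_subset_banach in auto)
    also have "infsum ?g (- F) = (\<Sum>\<^sub>\<infinity>k. (norm (trunc f (- F) k))\<^sup>2)"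
      by (rule infsum_cong_neutral) (auto simp: trunc_def)
    finally show ?thesis using that by (simp add: ell2_norm_def)
  qed
  have "\<forall>\<^sub>F F in finite_subsets_at_top UNIV.
      sqrt (infsum ?g UNIV - sum ?g F) = ell2_norm (trunc f (- F))"
    by (rule eventually_finite_subsets_at_top_weakI) (simp add: eq)
  from tendsto_cong[THEN iffD1, OF this lim] show ?thesis .
qed

section \<open>Bounded matrices\<close>

lemma bounded_mats_summable:
  "A \<in> bounded_mats \<Longrightarrow> f \<in> ell2 \<Longrightarrow> (\<lambda>l. A k l * f l) summable_on UNIV"
  by (simp add: bounded_mats_def)

lemma bounded_mats_ell2: "A \<in> bounded_mats \<Longrightarrow> f \<in> ell2 \<Longrightarrow> mat_apply A f \<in> ell2"
  by (auto simp: bounded_mats_def)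

lemma bounded_mats_bound:
  assumes "A \<in> bounded_mats"
  obtains C where "0 \<le> C" "\<And>f. f \<in> ell2 \<Longrightarrow> ell2_norm (mat_apply A f) \<le> C * ell2_norm f"
proof -
  from assms obtain C where C: "\<And>f. f \<in> ell2 \<Longrightarrow> ell2_norm (mat_apply A f) \<le> C * ell2_norm f"
    by (auto simp: bounded_mats_def)
  have "ell2_norm (mat_apply A f) \<le> \<bar>C\<bar> * ell2_norm f" if "f \<in> ell2" for f
    using C[OF that] mult_right_mono[OF abs_ge_self[of C] ell2_norm_nonneg[of f]] by linarith
  then show ?thesis by (intro that[of "\<bar>C\<bar>"]) auto
qed

lemma mat_apply_trunc:
  assumes "finite F"
  shows "mat_apply A (trunc f F) k = (\<Sum>l\<in>F. A k l * f l)"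
proof -
  have "mat_apply A (trunc f F) k = (\<Sum>l\<in>F. A k l * trunc f F l)"
    unfolding mat_apply_def by (rule infsum_finite_support) (use assms in \<open>auto simp: trunc_def\<close>)
  then show ?thesis by (simp add: trunc_def)
qed

lemma column_ell2:
  assumes "A \<in> bounded_mats"
  shows "(\<lambda>k. A k l) \<in> ell2"
proof -
  have "mat_apply A (trunc (\<lambda>_. 1) {l}) \<in> ell2"
    by (rule bounded_mats_ell2[OF assms]) (simp add: ell2_trunc_finite)
  moreover have "mat_apply A (trunc (\<lambda>_. 1) {l}) = (\<lambda>k. A k l)"
    by (simp add: fun_eq_iff mat_apply_trunc)
  ultimately show ?thesis by simp
qed

lemma L2_set_power2_sum: "(complex_of_real (L2_set (\<lambda>k. norm (f k)) F))\<^sup>2 = (\<Sum>k\<in>F. cnj (f k) * f k)"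
proof -
  have "(L2_set (\<lambda>k. norm (f k)) F)\<^sup>2 = (\<Sum>k\<in>F. (norm (f k))\<^sup>2)"
    unfolding L2_set_def by (intro real_sqrt_pow2 sum_nonneg) auto
  then have "complex_of_real ((L2_set (\<lambda>k. norm (f k)) F)\<^sup>2) = (\<Sum>k\<in>F. complex_of_real ((norm (f k))\<^sup>2))"
    by (metis of_real_sum)
  also have "\<dots> = (\<Sum>k\<in>F. cnj (f k) * f k)"
    by (intro sum.cong refl) (metis complex_norm_square mult.commute)
  finally show ?thesis by simp
qed

text \<open>Serves to cancel a norm that occurs on both sides of an estimate; the case
  \<open>x = 0\<close> cannot be divided out.\<close>

lemma le_of_power2_le_mult:
  fixes x c :: real
  assumes "0 \<le> x" "0 \<le> c" "x\<^sup>2 \<le> c * x"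
  shows "x \<le> c"
  using assms by (cases "x = 0") (auto simp: power2_eq_square)

text \<open>Testing \<open>A\<close> on truncations of \<open>cnj (A\<^sup>T f)\<close> bounds the partial sums of \<open>A\<^sup>T f\<close>.\<close>

lemma transpose_bounded:
  assumes A: "A \<in> bounded_mats"
  shows "mat_transpose A \<in> bounded_mats"
proof -
  obtain C where C: "0 \<le> C" "\<And>f. f \<in> ell2 \<Longrightarrow> ell2_norm (mat_apply A f) \<le> C * ell2_norm f"
    using bounded_mats_bound[OF A] by blast
  have sm: "(\<lambda>k. A k l * f k) summable_on UNIV" if "f \<in> ell2" for f l
    by (rule ell2_summable_mult[OF column_ell2[OF A] that])
  have le: "L2_set (\<lambda>l. norm (mat_apply (mat_transpose A) f l)) F \<le> C * ell2_norm f"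
    if f: "f \<in> ell2" and F: "finite F" for f F
  proof -
    define g where "g = mat_apply (mat_transpose A) f"
    define h where "h = trunc (\<lambda>l. cnj (g l)) F"
    let ?N = "L2_set (\<lambda>l. norm (g l)) F"
    have h: "h \<in> ell2" "ell2_norm h = ?N"
      unfolding h_def using F by (simp_all add: ell2_trunc_finite ell2_norm_trunc)
    have "(complex_of_real ?N)\<^sup>2 = (\<Sum>l\<in>F. cnj (g l) * (\<Sum>\<^sub>\<infinity>k. A k l * f k))"
      unfolding L2_set_power2_sum by (simp add: g_def mat_apply_def mat_transpose_def)
    also have "\<dots> = (\<Sum>l\<in>F. \<Sum>\<^sub>\<infinity>k. cnj (g l) * (A k l * f k))"
      by (simp add: infsum_cmult_right')
    also have "\<dots> = (\<Sum>\<^sub>\<infinity>k. \<Sum>l\<in>F. cnj (g l) * (A k l * f k))"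
      by (rule infsum_finite_sum[OF F]) (intro summable_on_cmult_right sm f)
    also have "\<dots> = (\<Sum>\<^sub>\<infinity>k. mat_apply A h k * f k)"
      unfolding h_def mat_apply_trunc[OF F] sum_distrib_right by (simp add: mult_ac)
    finally have "norm ((complex_of_real ?N)\<^sup>2) = norm (\<Sum>\<^sub>\<infinity>k. mat_apply A h k * f k)"
      by (rule arg_cong)
    then have "?N\<^sup>2 = norm (\<Sum>\<^sub>\<infinity>k. mat_apply A h k * f k)"
      by (simp add: norm_power)
    also have "\<dots> \<le> ell2_norm (mat_apply A h) * ell2_norm f"
      by (rule ell2_Cauchy_Schwarz[OF bounded_mats_ell2[OF A h(1)] f])
    also have "\<dots> \<le> (C * ?N) * ell2_norm f"
      using C(2)[OF h(1)] unfolding h(2) by (rule mult_right_mono) (rule ell2_norm_nonneg)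
    \<comment> \<open>One factor \<open>?N\<close> cancels, and what is left does not depend on
      \<open>F\<close>.\<close>
    finally have "?N\<^sup>2 \<le> (C * ell2_norm f) * ?N" by (simp only: mult_ac)
    then show ?thesis unfolding g_def[symmetric]
      by (rule le_of_power2_le_mult[rotated 2]) (simp_all add: C(1) ell2_norm_nonneg)
  qed
  show ?thesis
    unfolding bounded_mats_def mem_Collect_eq
  proof (intro conjI ballI allI exI)
    fix f :: "'a zvec" and k assume f: "f \<in> ell2"
    show "(\<lambda>l. mat_transpose A k l * f l) summable_on UNIV"
      using sm[OF f] by (simp add: mat_transpose_def)
    show "mat_apply (mat_transpose A) f \<in> ell2" by (rule ell2I[OF le[OF f]])
    show "ell2_norm (mat_apply (mat_transpose A) f) \<le> C * ell2_norm f"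
      by (rule ell2_norm_le[OF le[OF f]])
  qed
qed

text \<open>Columns are images of unit vectors, rows are not; they are reached as columns of the
  transpose. Entries of products pair rows with columns.\<close>

lemma row_ell2: "A \<in> bounded_mats \<Longrightarrow> (\<lambda>l. A k l) \<in> ell2"
  using column_ell2[OF transpose_bounded] by (simp add: mat_transpose_def)

text \<open>The family \<open>r k * A k l * f l\<close> need not be absolutely summable over pairs,
  which rules out a Fubini argument. Cutting \<open>f\<close> to a finite set \<open>F\<close> makes
  the interchange a finite one, and the error is at most \<open>ell2_norm r * C\<close> times the
  norm of the tail of \<open>f\<close>.\<close>

lemma infsum_transpose:
  assumes A: "A \<in> bounded_mats" and r: "r \<in> ell2" and f: "f \<in> ell2"
  shows "(\<Sum>\<^sub>\<infinity>k. r k * mat_apply A f k) = (\<Sum>\<^sub>\<infinity>l. mat_apply (mat_transpose A) r l * f l)"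
proof -
  obtain C where C: "0 \<le> C" "\<And>f. f \<in> ell2 \<Longrightarrow> ell2_norm (mat_apply A f) \<le> C * ell2_norm f"
    using bounded_mats_bound[OF A] by blast
  let ?L = "\<Sum>\<^sub>\<infinity>k. r k * mat_apply A f k"
  let ?a = "\<lambda>l. mat_apply (mat_transpose A) r l * f l"
  have partial: "norm (sum ?a F - ?L) \<le> ell2_norm r * (C * ell2_norm (trunc f (- F)))"
    if F: "finite F" for F
  proof -
    have tl: "trunc f (- F) \<in> ell2" by (rule ell2_trunc[OF f])
    have split: "mat_apply A f k = mat_apply A (trunc f F) k + mat_apply A (trunc f (- F)) k" for k
    proof -
      have "mat_apply A f k = (\<Sum>\<^sub>\<infinity>l. A k l * trunc f F l + A k l * trunc f (- F) l)"
        unfolding mat_apply_def by (rule infsum_cong) (simp add: trunc_def)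
      also have "\<dots> = mat_apply A (trunc f F) k + mat_apply A (trunc f (- F)) k"
        unfolding mat_apply_def
        by (intro infsum_add bounded_mats_summable[OF A] tl ell2_trunc[OF f])
      finally show ?thesis .
    qed
    have "sum ?a F = (\<Sum>l\<in>F. \<Sum>\<^sub>\<infinity>k. A k l * r k * f l)"
      by (simp add: mat_apply_def mat_transpose_def infsum_cmult_left')
    also have "\<dots> = (\<Sum>\<^sub>\<infinity>k. \<Sum>l\<in>F. A k l * r k * f l)"
      by (rule infsum_finite_sum[OF F])
         (intro summable_on_cmult_left ell2_summable_mult column_ell2[OF A] r)
    also have "\<dots> = (\<Sum>\<^sub>\<infinity>k. r k * mat_apply A (trunc f F) k)"
      unfolding mat_apply_trunc[OF F] sum_distrib_left by (simp add: mult_ac)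
    finally have 1: "sum ?a F = (\<Sum>\<^sub>\<infinity>k. r k * mat_apply A (trunc f F) k)" .
    have "?L = (\<Sum>\<^sub>\<infinity>k. r k * mat_apply A (trunc f F) k + r k * mat_apply A (trunc f (- F)) k)"
      by (simp add: split ring_distribs)
    also have "\<dots> = (\<Sum>\<^sub>\<infinity>k. r k * mat_apply A (trunc f F) k) + (\<Sum>\<^sub>\<infinity>k. r k * mat_apply A (trunc f (- F)) k)"
      by (intro infsum_add ell2_summable_mult r bounded_mats_ell2[OF A] tl ell2_trunc[OF f])
    finally have "norm (sum ?a F - ?L) = norm (\<Sum>\<^sub>\<infinity>k. r k * mat_apply A (trunc f (- F)) k)"
      using 1 by simp
    also have "\<dots> \<le> ell2_norm r * ell2_norm (mat_apply A (trunc f (- F)))"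
      by (rule ell2_Cauchy_Schwarz[OF r bounded_mats_ell2[OF A tl]])
    also have "\<dots> \<le> ell2_norm r * (C * ell2_norm (trunc f (- F)))"
      by (intro mult_left_mono C(2) tl ell2_norm_nonneg)
    finally show ?thesis .
  qed
  have "((\<lambda>F. ell2_norm r * (C * ell2_norm (trunc f (- F)))) \<longlongrightarrow> ell2_norm r * (C * 0))
      (finite_subsets_at_top UNIV)"
    by (intro tendsto_intros tail_tendsto_0 f)
  then have "((\<lambda>F. ell2_norm r * (C * ell2_norm (trunc f (- F)))) \<longlongrightarrow> 0) (finite_subsets_at_top UNIV)"
    by simp
  then have "((\<lambda>F. sum ?a F - ?L) \<longlongrightarrow> 0) (finite_subsets_at_top UNIV)"
    by (rule Lim_null_comparison[rotated])
       (intro eventually_finite_subsets_at_top_weakI partial)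
  then have "(?a has_sum ?L) UNIV"
    unfolding has_sum_def using LIM_zero_cancel by blast
  then show ?thesis by (simp add: infsumI)
qed

section \<open>Products of bounded matrices\<close>

lemma mat_apply_mult:
  assumes A: "A \<in> bounded_mats" and B: "B \<in> bounded_mats" and f: "f \<in> ell2"
  shows "mat_apply (mat_mult A B) f = mat_apply A (mat_apply B f)"
proof
  fix k
  \<comment> \<open>With the \<open>k\<close>-th row of \<open>A\<close> as left vector, moving
    \<open>B\<close> across the pairing turns that row into the \<open>k\<close>-th row of the
    product.\<close>
  have "mat_apply A (mat_apply B f) k = (\<Sum>\<^sub>\<infinity>l. mat_apply (mat_transpose B) (\<lambda>l. A k l) l * f l)"
    unfolding mat_apply_def[of A] by (rule infsum_transpose[OF B row_ell2[OF A] f])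
  moreover have "mat_apply (mat_transpose B) (\<lambda>l. A k l) l = mat_mult A B k l" for l
    by (simp add: mat_apply_def mat_mult_def mat_transpose_def mult.commute)
  ultimately show "mat_apply (mat_mult A B) f k = mat_apply A (mat_apply B f) k"
    by (simp add: mat_apply_def[of "mat_mult A B"])
qed

lemma mat_mult_bounded:
  assumes A: "A \<in> bounded_mats" and B: "B \<in> bounded_mats"
  shows "mat_mult A B \<in> bounded_mats"
proof -
  obtain C where C: "0 \<le> C" "\<And>f. f \<in> ell2 \<Longrightarrow> ell2_norm (mat_apply A f) \<le> C * ell2_norm f"
    using bounded_mats_bound[OF A] by blast
  obtain D where D: "0 \<le> D" "\<And>f. f \<in> ell2 \<Longrightarrow> ell2_norm (mat_apply B f) \<le> D * ell2_norm f"
    using bounded_mats_bound[OF B] by blast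
  show ?thesis
    unfolding bounded_mats_def mem_Collect_eq
  proof (intro conjI ballI allI exI)
    fix f :: "'a zvec" and k assume f: "f \<in> ell2"
    \<comment> \<open>Up to the order of factors this vector is the \<open>k\<close>-th row of the
      product; its square-summability gives the summability clause.\<close>
    have "mat_apply (mat_transpose B) (\<lambda>l. A k l) \<in> ell2"
      by (intro bounded_mats_ell2 transpose_bounded row_ell2 A B)
    then have "(\<lambda>l. mat_mult A B k l) \<in> ell2"
      by (simp add: mat_mult_def mat_apply_def mat_transpose_def mult.commute)
    then show "(\<lambda>l. mat_mult A B k l * f l) summable_on UNIV"
      by (rule ell2_summable_mult[OF _ f])
    show "mat_apply (mat_mult A B) f \<in> ell2"
      unfolding mat_apply_mult[OF A B f] by (intro bounded_mats_ell2 A B f)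
    have "ell2_norm (mat_apply (mat_mult A B) f) \<le> C * ell2_norm (mat_apply B f)"
      unfolding mat_apply_mult[OF A B f] by (intro C(2) bounded_mats_ell2 B f)
    also have "\<dots> \<le> C * (D * ell2_norm f)" by (intro mult_left_mono C(1) D(2) f)
    finally show "ell2_norm (mat_apply (mat_mult A B) f) \<le> (C * D) * ell2_norm f"
      by (simp add: mult_ac)
  qed
qed

lemma mat_mult_column: "(\<lambda>k. mat_mult A B k l) = mat_apply A (\<lambda>k. B k l)"
  by (simp add: mat_mult_def mat_apply_def)

text \<open>Column by column this is \<open>mat_apply_mult\<close>; entrywise it is an interchange
  of two infinite sums.\<close>

lemma mat_mult_assoc:
  assumes A: "A \<in> bounded_mats" and B: "B \<in> bounded_mats" and C: "C \<in> bounded_mats"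
  shows "mat_mult (mat_mult A B) C = mat_mult A (mat_mult B C)"
proof -
  have "(\<lambda>k. mat_mult (mat_mult A B) C k l) = (\<lambda>k. mat_mult A (mat_mult B C) k l)" for l
    unfolding mat_mult_column by (rule mat_apply_mult[OF A B column_ell2[OF C]])
  then show ?thesis by (metis (no_types) ext)
qed

lemma mat_id_mult [simp]: "mat_mult mat_id A = A" and mat_mult_id [simp]: "mat_mult A mat_id = A"
proof -
  have "(\<Sum>\<^sub>\<infinity>m. mat_id k m * A m l) = (\<Sum>m\<in>{k}. mat_id k m * A m l)" for k l
    by (rule infsum_finite_support) (auto simp: mat_id_def)
  then show "mat_mult mat_id A = A" by (simp add: mat_mult_def mat_id_def)
  have "(\<Sum>\<^sub>\<infinity>m. A k m * mat_id m l) = (\<Sum>m\<in>{l}. A k m * mat_id m l)" for k l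
    by (rule infsum_finite_support) (auto simp: mat_id_def)
  then show "mat_mult A mat_id = A" by (simp add: mat_mult_def mat_id_def)
qed

lemma mat_apply_id [simp]: "mat_apply mat_id f = f"
proof -
  have "(\<Sum>\<^sub>\<infinity>m. mat_id k m * f m) = (\<Sum>m\<in>{k}. mat_id k m * f m)" for k
    by (rule infsum_finite_support) (auto simp: mat_id_def)
  then show ?thesis by (simp add: mat_apply_def mat_id_def)
qed

section \<open>Adjoints\<close>

lemma mat_adjoint_mult: "mat_adjoint (mat_mult A B) = mat_mult (mat_adjoint B) (mat_adjoint A)"
  by (simp add: mat_adjoint_def mat_mult_def fun_eq_iff flip: infsum_cnj) (simp add: mult.commute)

lemma mat_adjoint_id [simp]: "mat_adjoint mat_id = mat_id"
  by (auto simp: mat_adjoint_def mat_id_def fun_eq_iff)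

lemma ell2_cnj: "f \<in> ell2 \<Longrightarrow> (\<lambda>k. cnj (f k)) \<in> ell2"
  and ell2_norm_cnj: "ell2_norm (\<lambda>k. cnj (f k)) = ell2_norm f"
  by (simp_all add: ell2_def ell2_norm_def)

text \<open>Complex conjugation preserves \<open>ell2_norm\<close>, so this form carries boundedness
  from the transpose to the adjoint with the same constant.\<close>

lemma mat_apply_adjoint: "mat_apply (mat_adjoint A) f = (\<lambda>k. cnj (mat_apply (mat_transpose A) (\<lambda>k. cnj (f k)) k))"
  by (simp add: mat_apply_def mat_adjoint_def mat_transpose_def fun_eq_iff flip: infsum_cnj)

lemma adjoint_bounded:
  assumes A: "A \<in> bounded_mats"
  shows "mat_adjoint A \<in> bounded_mats"
proof -
  note T = transpose_bounded[OF A]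
  obtain C where C: "\<And>f. f \<in> ell2 \<Longrightarrow> ell2_norm (mat_apply (mat_transpose A) f) \<le> C * ell2_norm f"
    using bounded_mats_bound[OF T] by blast
  show ?thesis
    unfolding bounded_mats_def mem_Collect_eq
  proof (intro conjI ballI allI exI)
    fix f :: "'a zvec" and k assume f: "f \<in> ell2"
    note f' = ell2_cnj[OF f]
    have "(\<lambda>l. cnj (mat_transpose A k l * cnj (f l))) summable_on UNIV"
      using bounded_mats_summable[OF T f'] by (subst summable_on_cnj_iff)
    then show "(\<lambda>l. mat_adjoint A k l * f l) summable_on UNIV"
      by (simp add: mat_adjoint_def mat_transpose_def)
    show "mat_apply (mat_adjoint A) f \<in> ell2"
      unfolding mat_apply_adjoint by (intro ell2_cnj bounded_mats_ell2 T f')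
    show "ell2_norm (mat_apply (mat_adjoint A) f) \<le> C * ell2_norm f"
      unfolding mat_apply_adjoint ell2_norm_cnj using C[OF f'] by (simp add: ell2_norm_cnj)
  qed
qed

lemma infsum_adjoint:
  assumes A: "A \<in> bounded_mats" and g: "g \<in> ell2" and h: "h \<in> ell2"
  shows "(\<Sum>\<^sub>\<infinity>k. cnj (g k) * mat_apply (mat_adjoint A) h k) = (\<Sum>\<^sub>\<infinity>k. cnj (mat_apply A g k) * h k)"
proof -
  have "mat_apply (mat_transpose (mat_adjoint A)) (\<lambda>k. cnj (g k)) = (\<lambda>k. cnj (mat_apply A g k))"
    by (simp add: mat_apply_def mat_adjoint_def mat_transpose_def fun_eq_iff flip: infsum_cnj)
  then show ?thesis
    using infsum_transpose[OF adjoint_bounded[OF A] ell2_cnj[OF g] h] by simp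
qed

section \<open>Finite matrices\<close>

lemma finite_cube: "finite (cube n :: (int ^ 'd::finite) set)"
proof -
  let ?F = "(UNIV :: 'd set) \<rightarrow>\<^sub>E {- int n..int n}"
  have "finite ?F" by (intro finite_PiE) auto
  moreover have "cube n \<subseteq> vec_lambda ` ?F"
  proof
    fix k :: "int ^ 'd" assume "k \<in> cube n"
    then have "vec_nth k \<in> ?F" by (auto simp: cube_def abs_le_iff minus_le_iff)
    then show "k \<in> vec_lambda ` ?F" by (metis imageI vec_nth_inverse)
  qed
  ultimately show ?thesis using finite_surj by blast
qed

lemma fin_matD: "fin_mat n B \<Longrightarrow> k \<notin> cube n \<or> l \<notin> cube n \<Longrightarrow> B k l = 0"
  by (auto simp: fin_mat_def)

lemma fin_mat_apply:
  assumes "fin_mat n B"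
  shows "mat_apply B f k = (\<Sum>l\<in>cube n. B k l * f l)"
  unfolding mat_apply_def
  by (rule infsum_finite_support) (use fin_matD[OF assms] finite_cube in auto)

lemma fin_mat_apply_outside: "fin_mat n B \<Longrightarrow> k \<notin> cube n \<Longrightarrow> mat_apply B f k = 0"
  by (simp add: fin_mat_apply fin_matD)

lemma fin_mat_apply_ell2:
  assumes "fin_mat n B"
  shows "mat_apply B f \<in> ell2"
proof -
  have "mat_apply B f = trunc (mat_apply B f) (cube n)"
    by (auto simp: trunc_def fun_eq_iff fin_mat_apply_outside[OF assms])
  then show ?thesis using ell2_trunc_finite[OF finite_cube] by metis
qed

lemma fin_mat_row_ell2:
  assumes "fin_mat n B"
  shows "B k \<in> ell2"
proof -
  have "B k = trunc (B k) (cube n)"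
    by (auto simp: trunc_def fun_eq_iff fin_matD[OF assms])
  then show ?thesis using ell2_trunc_finite[OF finite_cube] by metis
qed

text \<open>The constant, a sum of row norms, may grow with the cube and only shows membership;
  bounds uniform in \<open>n\<close> are kept in \<open>op_norm\<close>.\<close>

lemma fin_mat_bounded:
  assumes B: "fin_mat n B"
  shows "B \<in> bounded_mats"
  unfolding bounded_mats_def mem_Collect_eq
proof (intro conjI ballI allI exI)
  fix f :: "'a zvec" and k assume f: "f \<in> ell2"
  show "(\<lambda>l. B k l * f l) summable_on UNIV"
    by (rule infsum_finite_support[OF finite_cube[of n]]) (simp add: fin_matD[OF B])
  show "mat_apply B f \<in> ell2" by (rule fin_mat_apply_ell2[OF B])
  have "mat_apply B f = trunc (mat_apply B f) (cube n)"
    by (auto simp: trunc_def fun_eq_iff fin_mat_apply_outside[OF B])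
  then have "ell2_norm (mat_apply B f) = L2_set (\<lambda>k. norm (mat_apply B f k)) (cube n)"
    using ell2_norm_trunc[OF finite_cube] by metis
  also have "\<dots> \<le> (\<Sum>k\<in>cube n. norm (mat_apply B f k))"
    by (rule L2_set_le_sum) simp
  also have "\<dots> \<le> (\<Sum>k\<in>cube n. ell2_norm (B k) * ell2_norm f)"
    unfolding mat_apply_def by (intro sum_mono ell2_Cauchy_Schwarz fin_mat_row_ell2[OF B] f)
  finally show "ell2_norm (mat_apply B f) \<le> (\<Sum>k\<in>cube n. ell2_norm (B k)) * ell2_norm f"
    by (simp add: sum_distrib_right)
qed

lemma fin_mat_cube_proj: "fin_mat n (cube_proj n)"
  by (simp add: fin_mat_def cube_proj_def)

lemma cube_proj_apply: "mat_apply (cube_proj n) f = trunc f (cube n)"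
proof
  fix k
  have "mat_apply (cube_proj n) f k = (\<Sum>l\<in>cube n. (if k = l then f l else 0))"
    unfolding fin_mat_apply[OF fin_mat_cube_proj] by (rule sum.cong) (auto simp: cube_proj_def)
  then show "mat_apply (cube_proj n) f k = trunc f (cube n) k"
    by (simp add: trunc_def sum.delta'[OF finite_cube])
qed

lemma cube_proj_mult: "mat_mult (cube_proj n) A k l = (if k \<in> cube n then A k l else 0)"
  using fun_cong[OF mat_mult_column[of "cube_proj n" A l], of k]
  by (simp add: cube_proj_apply trunc_def)

lemma mult_cube_proj: "mat_mult A (cube_proj n) k l = (if l \<in> cube n then A k l else 0)"
proof -
  have "mat_mult A (cube_proj n) k l = (\<Sum>m\<in>{l}. A k m * cube_proj n m l)"
    unfolding mat_mult_def by (rule infsum_finite_support) (auto simp: cube_proj_def)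
  then show ?thesis by (simp add: cube_proj_def)
qed

lemma finite_section_apply:
  "finite_section n A k l = (if k \<in> cube n \<and> l \<in> cube n then A k l else 0)"
  by (simp add: finite_section_def mult_cube_proj cube_proj_mult)

lemma fin_mat_finite_section: "fin_mat n (finite_section n A)"
  by (simp add: fin_mat_def finite_section_apply)

lemma finite_section_id: "finite_section n mat_id = cube_proj n"
  by (auto simp: fun_eq_iff finite_section_apply mat_id_def cube_proj_def)

lemma fin_mat_mult: "fin_mat n B \<Longrightarrow> fin_mat n C \<Longrightarrow> fin_mat n (mat_mult B C)"
  unfolding fin_mat_def mat_mult_def by (auto intro!: infsum_0)

lemma fin_mat_apply_trunc:
  assumes "fin_mat n B"
  shows "mat_apply B (trunc f (cube n)) = mat_apply B f"
  by (simp add: fun_eq_iff fin_mat_apply[OF assms] trunc_def)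

text \<open>Boundedness of \<open>A\<close> makes the set under the real supremum bounded above, as
  \<open>cSUP_upper\<close> requires; then \<open>f\<close> is rescaled into the unit ball.\<close>

lemma op_norm_bound:
  assumes "A \<in> bounded_mats" "f \<in> ell2"
  shows "ell2_norm (mat_apply A f) \<le> op_norm A * ell2_norm f"
proof (cases "ell2_norm f = 0")
  case True
  then show ?thesis using bounded_mats_bound[OF assms(1)] assms(2)
    by (metis mult_zero_right)
next
  case False
  let ?c = "ell2_norm f"
  have c: "?c > 0" using False ell2_norm_nonneg[of f] by simp
  obtain C where C: "0 \<le> C" "\<And>f. f \<in> ell2 \<Longrightarrow> ell2_norm (mat_apply A f) \<le> C * ell2_norm f"
    using bounded_mats_bound[OF assms(1)] by blast
  have scale: "ell2_norm (\<lambda>k. complex_of_real (1 / ?c) * h k) = ell2_norm h / ?c" for h :: "'a zvec"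
    using c by (simp add: ell2_norm_def norm_divide power_divide divide_inverse
        infsum_cmult_left' infsum_cmult_right' real_sqrt_mult real_sqrt_inverse norm_inverse
        power_inverse norm_mult power_mult_distrib mult.commute)
  define g where "g = (\<lambda>k. complex_of_real (1 / ?c) * f k)"
  have g: "g \<in> ell2"
    using assms(2) by (simp add: ell2_def g_def norm_divide norm_mult power_divide power_mult_distrib
        divide_inverse summable_on_cmult_right)
  have gn: "ell2_norm g \<le> 1" unfolding g_def scale using c by simp
  have Ag: "mat_apply A g = (\<lambda>k. complex_of_real (1 / ?c) * mat_apply A f k)"
    unfolding g_def mat_apply_def infsum_cmult_right'[symmetric] by (simp add: mult_ac)
  have "ell2_norm (mat_apply A g) \<le> op_norm A"
    unfolding op_norm_def
  proof (rule cSUP_upper)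
    show "bdd_above ((\<lambda>f. ell2_norm (mat_apply A f)) ` {f \<in> ell2. ell2_norm f \<le> 1})"
    proof (rule bdd_aboveI2)
      fix h :: "'a zvec" assume "h \<in> {f \<in> ell2. ell2_norm f \<le> 1}"
      then show "ell2_norm (mat_apply A h) \<le> C * 1"
        using C mult_left_mono[of "ell2_norm h" 1 C] by (auto intro: order_trans)
    qed
  qed (use g gn in auto)
  then show ?thesis unfolding Ag scale using c by (simp add: divide_simps)
qed

lemma op_norm_le:
  assumes "0 \<le> C" "\<And>f. f \<in> ell2 \<Longrightarrow> ell2_norm (mat_apply A f) \<le> C * ell2_norm f"
  shows "op_norm A \<le> C"
  unfolding op_norm_def
proof (rule cSUP_least)
  have "(\<lambda>_. 0) \<in> {f :: 'a zvec. f \<in> ell2 \<and> ell2_norm f \<le> 1}" by (simp add: ell2_def ell2_norm_def)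
  then show "{f :: 'a zvec. f \<in> ell2 \<and> ell2_norm f \<le> 1} \<noteq> {}" by blast
  fix f :: "'a zvec" assume f: "f \<in> {f. f \<in> ell2 \<and> ell2_norm f \<le> 1}"
  then have "ell2_norm (mat_apply A f) \<le> C * ell2_norm f" using assms(2) by blast
  also have "\<dots> \<le> C" using f mult_left_mono[of "ell2_norm f" 1 C] assms(1) by simp
  finally show "ell2_norm (mat_apply A f) \<le> C" .
qed

text \<open>The images of the unit vectors are independent, so by cardinality they span the vectors
  supported on the cube.\<close>

lemma fin_mat_injective_imp_surjective:
  fixes B :: "('d::finite) zmat"
  assumes B: "fin_mat n B"
    and inj: "\<And>g. (\<And>k. k \<notin> cube n \<Longrightarrow> g k = 0) \<Longrightarrow> mat_apply B g = (\<lambda>_. 0) \<Longrightarrow> g = (\<lambda>_. 0)"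
    and b: "\<And>k. k \<notin> cube n \<Longrightarrow> b k = 0"
  shows "\<exists>x. (\<forall>k. k \<notin> cube n \<longrightarrow> x k = 0) \<and> mat_apply B x = b"
proof -
  interpret vs: vector_space "\<lambda>(c::complex) (f::'d zvec) k. c * f k"
    by unfold_locales (auto simp: fun_eq_iff algebra_simps)
  let ?S = "cube n :: (int ^ 'd) set"
  define e :: "int ^ 'd \<Rightarrow> 'd zvec" where "e = (\<lambda>l k. if k = l then 1 else 0)"
  define u where "u = (\<lambda>l k. B k l)"
  have comb: "(\<Sum>l\<in>F. (\<lambda>k. c l * h l k)) = (\<lambda>k. \<Sum>l\<in>F. c l * h l k)"
    for F :: "(int ^ 'd) set" and c :: "int ^ 'd \<Rightarrow> complex" and h :: "int ^ 'd \<Rightarrow> 'd zvec"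
    by (induction F rule: infinite_finite_induct) (auto simp: fun_eq_iff)
  have app: "mat_apply B (trunc c ?S) = (\<Sum>l\<in>?S. (\<lambda>k. c l * u l k))" for c
    unfolding comb by (simp add: fun_eq_iff mat_apply_trunc[OF finite_cube] u_def mult.commute)
  have zero: "c l = 0" if "(\<Sum>l\<in>?S. (\<lambda>k. c l * u l k)) = 0" "l \<in> ?S" for c l
  proof -
    have "trunc c ?S = (\<lambda>_. 0)"
    proof (rule inj)
      show "mat_apply B (trunc c ?S) = (\<lambda>_. 0)"
        unfolding app using that(1) by (simp add: zero_fun_def)
    qed (simp add: trunc_def)
    then show ?thesis using that(2) by (metis trunc_def)
  qed
  have inj_u: "inj_on u ?S"
  proof (rule inj_onI, rule ccontr)
    fix x y assume xy: "x \<in> ?S" "y \<in> ?S" "u x = u y" "x \<noteq> y"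
    \<comment> \<open>Two equal columns would give this nontrivial relation. Their distinctness lets
      the set of columns have as many elements as the cube.\<close>
    define c :: "int ^ 'd \<Rightarrow> complex" where "c = (\<lambda>l. if l = x then 1 else if l = y then - 1 else 0)"
    have "(\<Sum>l\<in>?S. (\<lambda>k. c l * u l k)) = (\<Sum>l\<in>{x, y}. (\<lambda>k. c l * u l k))"
      by (rule sum.mono_neutral_right[OF finite_cube]) (use xy in \<open>auto simp: c_def fun_eq_iff\<close>)
    also have "\<dots> = 0" using xy by (simp add: c_def fun_eq_iff)
    finally have "c x = 0" by (rule zero[OF _ xy(1)])
    then show False by (simp add: c_def)
  qed
  have ind: "vs.independent (u ` ?S)"
  proof (rule vs.independent_if_scalars_zero)
    fix f x assume s: "(\<Sum>x\<in>u ` ?S. (\<lambda>k. f x * x k)) = 0" and x: "x \<in> u ` ?S"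
    then obtain l where l: "l \<in> ?S" "x = u l" by blast
    from s have "(\<Sum>l\<in>?S. (\<lambda>k. f (u l) * u l k)) = 0" by (simp add: sum.reindex[OF inj_u])
    from zero[OF this l(1)] show "f x = 0" by (simp add: l(2))
  qed (simp add: finite_cube)
  have inj_e: "inj_on e ?S"
    by (rule inj_onI) (metis e_def one_neq_zero)
  have span_e: "g \<in> vs.span (e ` ?S)" if "\<And>k. k \<notin> ?S \<Longrightarrow> g k = 0" for g
  proof -
    have "g = (\<Sum>l\<in>?S. (\<lambda>k. g l * e l k))"
    proof
      fix k
      have "(\<Sum>l\<in>?S. g l * e l k) = (\<Sum>l\<in>?S. if k = l then g l else 0)"
        by (rule sum.cong) (auto simp: e_def)
      then show "g k = (\<Sum>l\<in>?S. (\<lambda>k. g l * e l k)) k"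
        using that unfolding comb by (auto simp: sum.delta'[OF finite_cube])
    qed
    moreover have "(\<Sum>l\<in>?S. (\<lambda>k. g l * e l k)) \<in> vs.span (e ` ?S)"
      by (intro vs.span_sum vs.span_scale vs.span_base) auto
    ultimately show ?thesis by simp
  qed
  have "u ` ?S \<subseteq> vs.span (e ` ?S)"
    using span_e by (auto simp: u_def fin_matD[OF B])
  note indep_bound = vs.independent_span_bound[OF finite_imageI[OF finite_cube], of _ e n]
  have "e l \<in> vs.span (u ` ?S)" if l: "l \<in> ?S" for l
  proof (rule ccontr)
    \<comment> \<open>Adjoining \<open>e l\<close> would give one more independent vector than there
      are spanning unit vectors.\<close>
    assume nl: "e l \<notin> vs.span (u ` ?S)"
    then have "vs.independent (insert (e l) (u ` ?S))"
      using ind by (simp add: vs.independent_insert)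
    then have "card (insert (e l) (u ` ?S)) \<le> card (e ` ?S)"
      using \<open>u ` ?S \<subseteq> _\<close> l by (intro indep_bound[THEN conjunct2]) (auto intro: vs.span_base)
    moreover have "e l \<notin> u ` ?S" using nl vs.span_base by blast
    ultimately show False
      using card_image[OF inj_u] card_image[OF inj_e] finite_imageI[OF finite_cube, of u n] by simp
  qed
  then have "vs.span (e ` ?S) \<subseteq> vs.span (u ` ?S)"
    by (intro vs.span_minimal) auto
  with span_e[of b] b have "b \<in> vs.span (u ` ?S)" by blast
  then obtain c where "b = (\<Sum>v\<in>u ` ?S. (\<lambda>k. c v * v k))"
    unfolding vs.span_finite[OF finite_imageI[OF finite_cube]] by auto
  then have "b = mat_apply B (trunc (\<lambda>l. c (u l)) ?S)"
    unfolding app by (simp add: sum.reindex[OF inj_u])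
  then show ?thesis by (intro exI[of _ "trunc (\<lambda>l. c (u l)) ?S"]) (auto simp: trunc_def)
qed

text \<open>Solving for the columns of \<open>cube_proj n\<close> gives a right inverse
  \<open>X\<close>. It is also a left inverse because \<open>B\<close> sends the columns of
  \<open>mat_mult X B\<close> and of \<open>cube_proj n\<close> to the same vectors and is
  injective.\<close>

lemma fin_mat_injective_imp_inverse:
  fixes B :: "('d::finite) zmat"
  assumes B: "fin_mat n B"
    and inj: "\<And>g. (\<And>k. k \<notin> cube n \<Longrightarrow> g k = 0) \<Longrightarrow> mat_apply B g = (\<lambda>_. 0) \<Longrightarrow> g = (\<lambda>_. 0)"
  shows "\<exists>X. is_fin_inverse n B X"
proof -
  have "\<exists>x. (\<forall>k. k \<notin> cube n \<longrightarrow> x k = 0) \<and> mat_apply B x = (\<lambda>k. cube_proj n k l)" for l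
    by (rule fin_mat_injective_imp_surjective[OF B inj]) (auto simp: cube_proj_def)
  then obtain x where x: "\<And>l k. k \<notin> cube n \<Longrightarrow> x l k = 0"
      "\<And>l. mat_apply B (x l) = (\<lambda>k. cube_proj n k l)" by metis
  define X where "X = (\<lambda>k l. if l \<in> cube n then x l k else 0)"
  have X: "fin_mat n X" by (auto simp: fin_mat_def X_def x)
  have BX: "mat_mult B X = cube_proj n"
  proof (intro ext)
    fix k l
    have "mat_mult B X k l = mat_apply B (\<lambda>k. X k l) k" by (metis mat_mult_column)
    also have "\<dots> = cube_proj n k l"
    proof (cases "l \<in> cube n")
      case True then show ?thesis by (simp add: X_def x(2))
    next
      case False then show ?thesis by (auto simp: X_def mat_apply_def cube_proj_def)
    qed
    finally show "mat_mult B X k l = cube_proj n k l" .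
  qed
  have b: "B \<in> bounded_mats" "X \<in> bounded_mats" using fin_mat_bounded B X by auto
  have "(\<lambda>k. mat_mult X B k l - cube_proj n k l) = (\<lambda>_. 0)" for l
  proof (rule inj)
    show "mat_mult X B k l - cube_proj n k l = 0" if "k \<notin> cube n" for k
      using fin_matD[OF fin_mat_mult[OF X B], of k l] that by (simp add: cube_proj_def)
    have "mat_apply B (\<lambda>k. mat_mult X B k l) k = mat_apply B (\<lambda>k. cube_proj n k l) k" for k
    proof -
      have "mat_mult B (mat_mult X B) = mat_mult B (cube_proj n)"
        unfolding mat_mult_assoc[OF b b(1), symmetric] BX
        by (auto simp: fun_eq_iff cube_proj_mult mult_cube_proj fin_matD[OF B])
      then show ?thesis by (metis mat_mult_column)
    qed
    then show "mat_apply B (\<lambda>k. mat_mult X B k l - cube_proj n k l) = (\<lambda>_. 0)"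
      by (simp add: fun_eq_iff fin_mat_apply[OF B] right_diff_distrib sum_subtractf)
  qed
  then have "mat_mult X B = cube_proj n" by (simp add: fun_eq_iff)
  with X BX show ?thesis by (auto simp: is_fin_inverse_def)
qed

section \<open>Finite sections of \<open>A\<^sup>* A\<close>\<close>

text \<open>\<open>ennreal\<close> sends negative numbers to 0, hence \<open>max 0 C\<close>.
  Membership comes out because the bound is finite while the extended norm is infinite outside the
  algebra.\<close>

lemma ext_norm_le_iff: "ext_norm \<A> nrm X \<le> ennreal C \<longleftrightarrow> X \<in> \<A> \<and> nrm X \<le> max 0 C"
  by (auto simp: ext_norm_def ennreal_le_iff2 max_def top_unique)

lemma finite_mat_seqsI:
  assumes "\<And>n. 1 \<le> n \<Longrightarrow> fin_mat n (B n)" "\<And>n. 1 \<le> n \<Longrightarrow> ext_norm \<A> nrm (B n) \<le> ennreal C"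
  shows "B \<in> finite_mat_seqs \<A> nrm"
proof -
  have "(SUP n\<in>{1..}. ext_norm \<A> nrm (B n)) \<le> ennreal C"
    by (rule SUP_least) (use assms in auto)
  then have "(SUP n\<in>{1..}. ext_norm \<A> nrm (B n)) < \<infinity>"
    using ennreal_less_top[of C] by (auto intro: le_less_trans)
  with assms(1) show ?thesis by (simp add: finite_mat_seqs_def)
qed

lemma section_seqs_inverse_closed:
  assumes "seqs_inverse_closed \<A> nrm (finite_mat_seqs \<A> nrm)"
  shows "seqs_inverse_closed \<A> nrm (section_seqs \<A>)"
  unfolding seqs_inverse_closed_def
proof (intro ballI allI impI)
  fix S X and C :: real
  assume S: "S \<in> section_seqs \<A>" and H: "\<forall>n\<ge>1. is_fin_inverse n (S n) (X n) \<and>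
      ext_norm \<A> nrm (S n) \<le> ennreal C \<and> op_norm (X n) \<le> C"
  have "S \<in> finite_mat_seqs \<A> nrm"
    by (rule finite_mat_seqsI[of _ _ _ C])
       (use S H in \<open>auto simp: section_seqs_def fin_mat_finite_section\<close>)
  with assms H show "\<exists>C'. \<forall>n\<ge>1. ext_norm \<A> nrm (X n) \<le> ennreal C'"
    unfolding seqs_inverse_closed_def by blast
qed

lemma translation_conjugate:
  "mat_mult (mat_mult (translation (- l)) A) (translation l) = (\<lambda>k m. A (k + l) (m + l))"
proof -
  have 1: "mat_mult (translation (- l)) A = (\<lambda>k m. A (k + l) m)"
  proof (intro ext)
    fix k m
    have "mat_mult (translation (- l)) A k m = (\<Sum>p\<in>{k + l}. translation (- l) k p * A p m)"
      unfolding mat_mult_def by (rule infsum_finite_support) (auto simp: translation_def)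
    then show "mat_mult (translation (- l)) A k m = A (k + l) m" by (simp add: translation_def)
  qed
  show ?thesis unfolding 1
  proof (intro ext)
    fix k m
    have "mat_mult (\<lambda>k m. A (k + l) m) (translation l) k m =
        (\<Sum>p\<in>{m + l}. A (k + l) p * translation l p m)"
      unfolding mat_mult_def by (rule infsum_finite_support) (auto simp: translation_def)
    then show "mat_mult (\<lambda>k m. A (k + l) m) (translation l) k m = A (k + l) (m + l)"
      by (simp add: translation_def)
  qed
qed

text \<open>For a matrix that vanishes off the cube, embedding is mere translation, so the
  invariance of the norm applies to it.\<close>

lemma embed_fin_mat: "fin_mat n B \<Longrightarrow> embed n j B = (\<lambda>k l. B (k - j) (l - j))"
  by (auto simp: embed_def fin_mat_def fun_eq_iff)

lemma adjoint_mult_inverse: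
  assumes A: "A \<in> bounded_mats" and X: "is_l2_inverse A X"
  shows "is_l2_inverse (mat_mult (mat_adjoint A) A) (mat_mult X (mat_adjoint X))"
    and "X = mat_mult (mat_mult X (mat_adjoint X)) (mat_adjoint A)"
proof -
  have Xb: "X \<in> bounded_mats" and AX: "mat_mult A X = mat_id" and XA: "mat_mult X A = mat_id"
    using X by (auto simp: is_l2_inverse_def)
  note b = A Xb adjoint_bounded[OF A] adjoint_bounded[OF Xb] mat_mult_bounded
  have AX': "mat_mult (mat_adjoint A) (mat_adjoint X) = mat_id"
    by (simp add: XA flip: mat_adjoint_mult)
  have XA': "mat_mult (mat_adjoint X) (mat_adjoint A) = mat_id"
    by (simp add: AX flip: mat_adjoint_mult)
  have "mat_mult (mat_mult (mat_adjoint A) A) (mat_mult X (mat_adjoint X)) =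
      mat_mult (mat_adjoint A) (mat_mult (mat_mult A X) (mat_adjoint X))"
    by (simp add: mat_mult_assoc b)
  moreover have "mat_mult (mat_mult X (mat_adjoint X)) (mat_mult (mat_adjoint A) A) =
      mat_mult X (mat_mult (mat_mult (mat_adjoint X) (mat_adjoint A)) A)"
    by (simp add: mat_mult_assoc b)
  ultimately show "is_l2_inverse (mat_mult (mat_adjoint A) A) (mat_mult X (mat_adjoint X))"
    by (simp add: is_l2_inverse_def AX AX' XA XA' b)
  show "X = mat_mult (mat_mult X (mat_adjoint X)) (mat_adjoint A)"
    by (simp add: mat_mult_assoc b XA')
qed

text \<open>Finite sections of \<open>A\<^sup>* A\<close> are bounded below because \<open>\<langle>A\<^sup>* A g, g\<rangle> = \<parallel>A g\<parallel>\<^sup>2\<close>.\<close>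

lemma finite_section_bounded_below:
  assumes A: "A \<in> bounded_mats" and X: "X \<in> bounded_mats" "mat_mult X A = mat_id"
    and C: "0 \<le> C" "\<And>f. f \<in> ell2 \<Longrightarrow> ell2_norm (mat_apply X f) \<le> C * ell2_norm f"
    and g: "\<And>k. k \<notin> cube n \<Longrightarrow> g k = 0"
  shows "ell2_norm g \<le> C\<^sup>2 * ell2_norm (mat_apply (finite_section n (mat_mult (mat_adjoint A) A)) g)"
proof -
  let ?S = "finite_section n (mat_mult (mat_adjoint A) A)"
  have gt: "g = trunc g (cube n)" using g by (auto simp: trunc_def fun_eq_iff)
  have g2: "g \<in> ell2" using ell2_trunc_finite[OF finite_cube] gt by metis
  define h where "h = mat_apply A g"
  have h2: "h \<in> ell2" unfolding h_def by (rule bounded_mats_ell2[OF A g2])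
  have "g = mat_apply X h"
    unfolding h_def mat_apply_mult[OF X(1) A g2, symmetric] X(2) by simp
  then have gh: "ell2_norm g \<le> C * ell2_norm h" using C(2)[OF h2] by simp
  \<comment> \<open>Section and full operator are compared on the cube only; that suffices, as the
    pairing below is against \<open>g\<close>, which vanishes elsewhere.\<close>
  have S: "mat_apply ?S g k = mat_apply (mat_adjoint A) h k" if "k \<in> cube n" for k
  proof -
    have "mat_apply (mat_adjoint A) h k = mat_apply (mat_mult (mat_adjoint A) A) g k"
      unfolding h_def mat_apply_mult[OF adjoint_bounded[OF A] A g2] ..
    also have "\<dots> = mat_apply ?S g k"
      unfolding mat_apply_def by (rule infsum_cong) (use that g in \<open>auto simp: finite_section_apply\<close>)
    finally show ?thesis ..
  qed
  have "complex_of_real ((ell2_norm h)\<^sup>2) = (\<Sum>\<^sub>\<infinity>k. complex_of_real ((norm (h k))\<^sup>2))"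
    unfolding ell2_norm_power2 by (rule infsum_of_real[symmetric])
  also have "\<dots> = (\<Sum>\<^sub>\<infinity>k. cnj (h k) * h k)"
    by (rule infsum_cong) (metis complex_norm_square mult.commute of_real_power)
  also have "\<dots> = (\<Sum>\<^sub>\<infinity>k. cnj (g k) * mat_apply (mat_adjoint A) h k)"
    using infsum_adjoint[OF A g2 h2] by (simp add: h_def)
  also have "\<dots> = (\<Sum>\<^sub>\<infinity>k. cnj (g k) * mat_apply ?S g k)"
    by (rule infsum_cong) (metis S g complex_cnj_zero mult_zero_left)
  finally have "norm (complex_of_real ((ell2_norm h)\<^sup>2)) = norm (\<Sum>\<^sub>\<infinity>k. cnj (g k) * mat_apply ?S g k)"
    by (rule arg_cong)
  then have "(ell2_norm h)\<^sup>2 = norm (\<Sum>\<^sub>\<infinity>k. cnj (g k) * mat_apply ?S g k)"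
    by (simp add: norm_power)
  also have "\<dots> \<le> ell2_norm g * ell2_norm (mat_apply ?S g)"
    using ell2_Cauchy_Schwarz[OF ell2_cnj[OF g2] fin_mat_apply_ell2[OF fin_mat_finite_section]]
    unfolding ell2_norm_cnj .
  finally have hS: "(ell2_norm h)\<^sup>2 \<le> ell2_norm g * ell2_norm (mat_apply ?S g)" .
  \<comment> \<open>Squaring \<open>gh\<close> produces the constant \<open>C\<^sup>2\<close> and
    brings in the quadratic form; one factor \<open>ell2_norm g\<close> then cancels.\<close>
  have "(ell2_norm g)\<^sup>2 \<le> (C * ell2_norm h)\<^sup>2"
    by (rule power_mono[OF gh ell2_norm_nonneg])
  also have "\<dots> \<le> C\<^sup>2 * (ell2_norm g * ell2_norm (mat_apply ?S g))"
    unfolding power_mult_distrib by (rule mult_left_mono[OF hS]) simp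
  finally have "(ell2_norm g)\<^sup>2 \<le> (C\<^sup>2 * ell2_norm (mat_apply ?S g)) * ell2_norm g"
    by (simp only: mult_ac)
  then show ?thesis
    by (rule le_of_power2_le_mult[rotated 2]) (simp_all add: ell2_norm_nonneg)
qed

text \<open>The lower bound gives injectivity, hence an inverse by dimension; applied once more to
  vectors \<open>mat_apply Y f\<close> it bounds that inverse by the same \<open>C\<^sup>2\<close>
  for every \<open>n\<close>.\<close>

lemma finite_section_inverse:
  fixes A :: "('d::finite) zmat"
  assumes A: "A \<in> bounded_mats" and X: "X \<in> bounded_mats" "mat_mult X A = mat_id"
    and C: "0 \<le> C" "\<And>f. f \<in> ell2 \<Longrightarrow> ell2_norm (mat_apply X f) \<le> C * ell2_norm f"
  shows "\<exists>Y. is_fin_inverse n (finite_section n (mat_mult (mat_adjoint A) A)) Y \<and> op_norm Y \<le> C\<^sup>2"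
proof -
  let ?S = "finite_section n (mat_mult (mat_adjoint A) A)"
  note S = fin_mat_finite_section[of n "mat_mult (mat_adjoint A) A"]
  have below: "ell2_norm g \<le> C\<^sup>2 * ell2_norm (mat_apply ?S g)"
    if "\<And>k. k \<notin> cube n \<Longrightarrow> g k = 0" for g
    by (rule finite_section_bounded_below[OF A X]) (use C that in auto)
  have "\<exists>Y. is_fin_inverse n ?S Y"
  proof (rule fin_mat_injective_imp_inverse[OF S])
    fix g :: "'d zvec" assume g: "\<And>k. k \<notin> cube n \<Longrightarrow> g k = 0" "mat_apply ?S g = (\<lambda>_. 0)"
    have "g = trunc g (cube n)" using g(1) by (auto simp: trunc_def fun_eq_iff)
    then have "g \<in> ell2" using ell2_trunc_finite[OF finite_cube] by metis
    moreover have "ell2_norm g \<le> 0"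
      using below[of g] g by (simp add: ell2_norm_def)
    ultimately show "g = (\<lambda>_. 0)" using ell2_norm_eq_0 by blast
  qed
  then obtain Y where Y: "is_fin_inverse n ?S Y" ..
  then have Yf: "fin_mat n Y" and SY: "mat_mult ?S Y = cube_proj n" by (auto simp: is_fin_inverse_def)
  have "op_norm Y \<le> C\<^sup>2"
  proof (rule op_norm_le)
    fix f :: "'d zvec" assume f: "f \<in> ell2"
    have "ell2_norm (mat_apply Y f) \<le> C\<^sup>2 * ell2_norm (mat_apply ?S (mat_apply Y f))"
      by (rule below) (rule fin_mat_apply_outside[OF Yf])
    also have "mat_apply ?S (mat_apply Y f) = trunc f (cube n)"
      unfolding mat_apply_mult[OF fin_mat_bounded[OF S] fin_mat_bounded[OF Yf] f, symmetric] SY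
      by (rule cube_proj_apply)
    also have "C\<^sup>2 * ell2_norm (trunc f (cube n)) \<le> C\<^sup>2 * ell2_norm f"
      by (rule mult_left_mono[OF ell2_norm_trunc_le[OF f]]) simp
    finally show "ell2_norm (mat_apply Y f) \<le> C\<^sup>2 * ell2_norm f" .
  qed simp
  with Y show ?thesis by blast
qed

text \<open>The constant in (C1) may depend on the matrix. For one fixed matrix it merges with the
  norm into a bound over all sections, which is enough since (C1) is applied only to the identity
  and to one product \<open>A^* A\<close>.\<close>

lemma weakly_solid_bound:
  assumes "weakly_solid \<A> nrm" "A \<in> \<A>" "0 \<le> nrm A"
  obtains K where "0 \<le> K" "\<And>n. 1 \<le> n \<Longrightarrow> ext_norm \<A> nrm (finite_section n A) \<le> ennreal K"
proof -
  from assms(1,2) obtain C :: real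
    where "\<And>n. 1 \<le> n \<Longrightarrow> ext_norm \<A> nrm (finite_section n A) \<le> ennreal C * ext_norm \<A> nrm A"
    unfolding weakly_solid_def by blast
  then have "ext_norm \<A> nrm (finite_section n A) \<le> ennreal (C * nrm A)" if "1 \<le> n" for n
    using that assms(2,3) by (simp add: ext_norm_def ennreal_mult'')
  then show ?thesis by (intro that[of "max 0 (C * nrm A)"]) (auto simp: ext_norm_le_iff)
qed

section \<open>From finite sections back to the inverse on the whole lattice\<close>

context matrix_banach_algebra
begin

text \<open>Closure under adjoints enters twice: to have \<open>?T\<close> in the algebra, and to
  multiply its inverse by \<open>mat_adjoint A\<close> at the end.\<close>

lemma inverse_closed_if_section_seqs:
  assumes star: "star_closed \<A>" and solid: "weakly_solid \<A> nrm"
    and weak: "weakly_inverse_closed \<A> nrm"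
    and seqs: "seqs_inverse_closed \<A> nrm (section_seqs \<A>)"
  shows "inverse_closed \<A>"
  unfolding inverse_closed_def
proof (intro ballI allI impI)
  fix A X assume A: "A \<in> \<A>" and X: "is_l2_inverse A X"
  let ?T = "mat_mult (mat_adjoint A) A" and ?R = "mat_mult X (mat_adjoint X)"
  have A': "mat_adjoint A \<in> \<A>" using star A by (simp add: star_closed_def)
  have T: "?T \<in> \<A>" by (rule mult_closed[OF A' A])
  have Ab: "A \<in> bounded_mats" using A bounded by blast
  have Xb: "X \<in> bounded_mats" "mat_mult X A = mat_id" using X by (auto simp: is_l2_inverse_def)
  obtain C where C: "0 \<le> C" "\<And>f. f \<in> ell2 \<Longrightarrow> ell2_norm (mat_apply X f) \<le> C * ell2_norm f"
    using bounded_mats_bound[OF Xb(1)] by blast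
  obtain K where K: "0 \<le> K" "\<And>n. 1 \<le> n \<Longrightarrow> ext_norm \<A> nrm (finite_section n ?T) \<le> ennreal K"
    using weakly_solid_bound[OF solid T nrm_nonneg[OF T]] by blast
  obtain Y where Y: "\<And>n. is_fin_inverse n (finite_section n ?T) (Y n)" "\<And>n. op_norm (Y n) \<le> C\<^sup>2"
    using finite_section_inverse[OF Ab Xb C] by metis
  have "(\<lambda>n. finite_section n ?T) \<in> section_seqs \<A>"
    using T by (auto simp: section_seqs_def)
  \<comment> \<open>\<open>seqs_inverse_closed\<close> uses one constant for both bounds, hence the
    maximum of the (C1) bound \<open>K\<close> and the inverse bound
    \<open>C\<^sup>2\<close>.\<close>
  moreover have "is_fin_inverse n (finite_section n ?T) (Y n) \<and>
      ext_norm \<A> nrm (finite_section n ?T) \<le> ennreal (max K (C\<^sup>2)) \<and> op_norm (Y n) \<le> max K (C\<^sup>2)"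
    if "1 \<le> n" for n
    using Y[of n] K(1) K(2)[OF that] by (auto simp: ext_norm_le_iff le_max_iff_disj)
  ultimately obtain C' where C': "\<And>n. 1 \<le> n \<Longrightarrow> ext_norm \<A> nrm (Y n) \<le> ennreal C'"
    using seqs[unfolded seqs_inverse_closed_def, rule_format,
        of "\<lambda>n. finite_section n ?T" Y "max K (C\<^sup>2)"] by blast
  have "(SUP n\<in>{1..}. ext_norm \<A> nrm (Y n)) \<le> ennreal C'"
    by (rule SUP_least) (use C' in auto)
  then have "?R \<in> \<A>"
    using weak T adjoint_mult_inverse(1)[OF Ab X] Y(1) unfolding weakly_inverse_closed_def by blast
  then have "mat_mult ?R (mat_adjoint A) \<in> \<A>" by (rule mult_closed[OF _ A'])
  then show "X \<in> \<A>" using adjoint_mult_inverse(2)[OF Ab X] by simp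
qed

lemma
  assumes "translation_invariant \<A> nrm" "A \<in> \<A>"
  shows translate_closed: "(\<lambda>k m. A (k + l) (m + l)) \<in> \<A>"
    and nrm_translate: "nrm (\<lambda>k m. A (k + l) (m + l)) = nrm A"
proof -
  have e: "ext_norm \<A> nrm (\<lambda>k m. A (k + l) (m + l)) = ennreal (nrm A)"
    using assms unfolding translation_invariant_def translation_conjugate by (simp add: ext_norm_def)
  then show m: "(\<lambda>k m. A (k + l) (m + l)) \<in> \<A>"
    by (auto simp: ext_norm_def split: if_splits)
  show "nrm (\<lambda>k m. A (k + l) (m + l)) = nrm A"
    using e m nrm_nonneg[OF m] nrm_nonneg[OF assms(2)] by (simp add: ext_norm_def)
qed

lemma diff_closed: "A \<in> \<A> \<Longrightarrow> B \<in> \<A> \<Longrightarrow> mat_diff A B \<in> \<A>"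
  using add_closed[OF _ scale_closed, of A B "- 1"]
  by (simp add: mat_diff_def mat_add_def mat_scale_def)

end

section \<open>Block-diagonal matrices\<close>

lemma disjoint_cubes_unique:
  assumes "disjoint_cubes j" "1 \<le> m" "1 \<le> n" "k - j m \<in> cube m" "k - j n \<in> cube n"
  shows "m = n"
proof (rule ccontr)
  assume "m \<noteq> n"
  then have "(\<lambda>k. j m + k) ` cube m \<inter> (\<lambda>k. j n + k) ` cube n = {}"
    using assms by (auto simp: disjoint_cubes_def disjoint_family_on_def)
  moreover have "k \<in> (\<lambda>k. j m + k) ` cube m" using assms(4) by (intro image_eqI[of _ _ "k - j m"]) auto
  moreover have "k \<in> (\<lambda>k. j n + k) ` cube n" using assms(5) by (intro image_eqI[of _ _ "k - j n"]) auto
  ultimately show False by blast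
qed

text \<open>\<open>block_mat j B\<close> completed by the identity outside the cubes; products of such completions
  are formed block by block.\<close>

definition block_ext :: "(nat \<Rightarrow> int ^ 'd) \<Rightarrow> (nat \<Rightarrow> ('d::finite) zmat) \<Rightarrow> 'd zmat" where
  "block_ext j B = mat_add (block_mat j B) (mat_diff mat_id (block_mat j cube_proj))"

text \<open>The row index alone selects the block: a row meeting one cube carries no entries of
  other blocks, whatever the column \<open>l\<close>.\<close>

lemma block_mat_inside:
  assumes "disjoint_cubes j" "1 \<le> m" "k - j m \<in> cube m"
  shows "block_mat j B k l = embed m (j m) (B m) k l"
proof -
  have "block_mat j B k l = (\<Sum>\<^sub>\<infinity>m\<in>{m}. embed m (j m) (B m) k l)"
    unfolding block_mat_def
  proof (rule infsum_cong_neutral)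
    fix n assume "n \<in> {1..} - {m}"
    then have "k - j n \<notin> cube n" using disjoint_cubes_unique[OF assms(1,2) _ assms(3)] by auto
    then show "embed n (j n) (B n) k l = 0" by (simp add: embed_def)
  qed (use assms(2) in auto)
  then show ?thesis by simp
qed

lemma block_mat_outside:
  assumes "\<And>m. 1 \<le> m \<Longrightarrow> k - j m \<notin> cube m"
  shows "block_mat j B k l = 0"
  unfolding block_mat_def by (rule infsum_0) (use assms in \<open>auto simp: embed_def\<close>)

text \<open>On rows inside a cube \<open>mat_id\<close> and \<open>block_mat j cube_proj\<close>
  coincide, so the completing term vanishes.\<close>

lemma block_ext_inside:
  assumes "disjoint_cubes j" "1 \<le> m" "k - j m \<in> cube m"
  shows "block_ext j B k l = embed m (j m) (B m) k l"
  using assms(3) unfolding block_ext_def mat_add_def mat_diff_def block_mat_inside[OF assms]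
  by (auto simp: embed_def mat_id_def cube_proj_def)

lemma block_ext_outside:
  assumes "\<And>m. 1 \<le> m \<Longrightarrow> k - j m \<notin> cube m"
  shows "block_ext j B k l = mat_id k l"
  by (simp add: block_ext_def mat_add_def mat_diff_def block_mat_outside assms)

lemma block_ext_id: "block_ext j cube_proj = mat_id"
  by (simp add: block_ext_def mat_add_def mat_diff_def)

lemma block_ext_cong:
  assumes "\<And>m. 1 \<le> m \<Longrightarrow> B m = C m"
  shows "block_ext j B = block_ext j C"
proof -
  have "block_mat j B = block_mat j C"
    unfolding block_mat_def by (intro ext infsum_cong) (simp add: assms)
  then show ?thesis by (simp add: block_ext_def)
qed

text \<open>In a row of the cube at \<open>j m\<close> the left factor vanishes off that cube, so
  the sum runs over one block, and the shift \<open>p = q + j m\<close> turns it into a product of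
  finite matrices. The remaining rows are rows of the identity.\<close>

lemma block_ext_mult:
  assumes j: "disjoint_cubes j" and B: "\<And>m. 1 \<le> m \<Longrightarrow> fin_mat m (B m)"
    and C: "\<And>m. 1 \<le> m \<Longrightarrow> fin_mat m (C m)"
  shows "mat_mult (block_ext j B) (block_ext j C) = block_ext j (\<lambda>m. mat_mult (B m) (C m))"
proof (intro ext)
  fix k l
  show "mat_mult (block_ext j B) (block_ext j C) k l = block_ext j (\<lambda>m. mat_mult (B m) (C m)) k l"
  proof (cases "\<exists>m\<ge>1. k - j m \<in> cube m")
    case True
    then obtain m where m: "1 \<le> m" "k - j m \<in> cube m" by blast
    note e = embed_fin_mat[OF B[OF m(1)]] embed_fin_mat[OF C[OF m(1)]]
    have "mat_mult (block_ext j B) (block_ext j C) k l =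
        (\<Sum>\<^sub>\<infinity>p. B m (k - j m) (p - j m) * C m (p - j m) (l - j m))"
      unfolding mat_mult_def
    proof (rule infsum_cong)
      fix p
      show "block_ext j B k p * block_ext j C p l = B m (k - j m) (p - j m) * C m (p - j m) (l - j m)"
        using block_ext_inside[OF j m, of B p] block_ext_inside[OF j m(1), of p C l]
        by (cases "p - j m \<in> cube m") (simp_all add: e fin_matD[OF B[OF m(1)]])
    qed
    also have "\<dots> = (\<Sum>\<^sub>\<infinity>q. B m (k - j m) q * C m q (l - j m))"
      by (rule infsum_reindex_bij_witness[of _ "\<lambda>q. q + j m" "\<lambda>p. p - j m"]) auto
    also have "\<dots> = embed m (j m) (mat_mult (B m) (C m)) k l"
      unfolding embed_fin_mat[OF fin_mat_mult[OF B[OF m(1)] C[OF m(1)]]] by (simp add: mat_mult_def)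
    finally show ?thesis by (simp add: block_ext_inside[OF j m])
  next
    case False
    then have k: "\<And>m. 1 \<le> m \<Longrightarrow> k - j m \<notin> cube m" by blast
    have "mat_mult (block_ext j B) (block_ext j C) k l = mat_mult mat_id (block_ext j C) k l"
      unfolding mat_mult_def by (simp add: block_ext_outside[OF k])
    also have "\<dots> = mat_id k l" by (simp add: block_ext_outside[OF k])
    finally show ?thesis by (simp add: block_ext_outside[OF k])
  qed
qed

text \<open>The operator is an orthogonal sum of the blocks and an identity. The bound is proved
  directly because \<open>is_l2_inverse\<close> asks for boundedness of the glued inverse before it
  is known to lie in the algebra.\<close>

lemma block_ext_bounded:
  fixes B :: "nat \<Rightarrow> ('d::finite) zmat"
  assumes j: "disjoint_cubes j" and B: "\<And>m. 1 \<le> m \<Longrightarrow> fin_mat m (B m)"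
    and C: "\<And>m f. 1 \<le> m \<Longrightarrow> f \<in> ell2 \<Longrightarrow> ell2_norm (mat_apply (B m) f) \<le> C * ell2_norm f"
  shows "block_ext j B \<in> bounded_mats"
proof -
  \<comment> \<open>The 1 accounts for the identity outside the cubes.\<close>
  define D where "D = max 1 C"
  have D: "1 \<le> D" "C \<le> D" by (auto simp: D_def)
  define J where "J = (\<lambda>m. (\<lambda>k. k + j m) ` cube m)"
  have memJ: "k \<in> J m \<longleftrightarrow> k - j m \<in> cube m" for k m
    by (force simp: J_def)
  have finJ: "finite (J m)" for m by (simp add: J_def finite_cube)
  have inside: "mat_apply (block_ext j B) f k = mat_apply (B m) (\<lambda>q. f (q + j m)) (k - j m)"
    if m: "1 \<le> m" "k \<in> J m" for f k m
  proof -
    have "mat_apply (block_ext j B) f k = (\<Sum>\<^sub>\<infinity>p. B m (k - j m) (p - j m) * f p)"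
      unfolding mat_apply_def block_ext_inside[OF j m(1) m(2)[unfolded memJ]] embed_fin_mat[OF B[OF m(1)]] ..
    also have "\<dots> = (\<Sum>\<^sub>\<infinity>q. B m (k - j m) q * f (q + j m))"
      by (rule infsum_reindex_bij_witness[of _ "\<lambda>q. q + j m" "\<lambda>p. p - j m"]) auto
    finally show ?thesis by (simp add: mat_apply_def)
  qed
  have outside: "mat_apply (block_ext j B) f k = f k" if "\<And>m. 1 \<le> m \<Longrightarrow> k \<notin> J m" for f k
  proof -
    have "mat_apply (block_ext j B) f k = mat_apply mat_id f k"
      unfolding mat_apply_def using that by (simp add: memJ block_ext_outside)
    then show ?thesis by simp
  qed
  have block: "(\<Sum>k\<in>J m. (norm (mat_apply (block_ext j B) f k))\<^sup>2) \<le> D\<^sup>2 * (\<Sum>k\<in>J m. (norm (f k))\<^sup>2)"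
    if m: "1 \<le> m" for f m
  proof -
    define g where "g = (\<lambda>q. f (q + j m))"
    let ?t = "trunc g (cube m)"
    have t: "?t \<in> ell2" by (rule ell2_trunc_finite[OF finite_cube])
    have inj: "inj_on (\<lambda>k. k + j m) (cube m)" by (simp add: inj_on_def)
    have "L2_set (\<lambda>q. norm (mat_apply (B m) g q)) (cube m) \<le> ell2_norm (mat_apply (B m) g)"
      by (rule L2_set_le_ell2_norm[OF fin_mat_apply_ell2[OF B[OF m]] finite_cube])
    \<comment> \<open>\<open>B m\<close> ignores \<open>g\<close> off the cube, so the estimate
      involves only the part of \<open>f\<close> in this block, and the blocks can be added
      up.\<close>
    also have "\<dots> = ell2_norm (mat_apply (B m) ?t)"
      by (simp add: fin_mat_apply_trunc[OF B[OF m]])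
    also have "\<dots> \<le> C * ell2_norm ?t" by (rule C[OF m t])
    also have "\<dots> \<le> D * ell2_norm ?t" by (rule mult_right_mono[OF D(2) ell2_norm_nonneg])
    also have "\<dots> = D * L2_set (\<lambda>q. norm (g q)) (cube m)" by (simp add: ell2_norm_trunc[OF finite_cube])
    finally have "(L2_set (\<lambda>q. norm (mat_apply (B m) g q)) (cube m))\<^sup>2 \<le> (D * L2_set (\<lambda>q. norm (g q)) (cube m))\<^sup>2"
      by (rule power_mono) simp
    then have "(\<Sum>q\<in>cube m. (norm (mat_apply (B m) g q))\<^sup>2) \<le> D\<^sup>2 * (\<Sum>q\<in>cube m. (norm (g q))\<^sup>2)"
      by (simp add: L2_set_def power_mult_distrib sum_nonneg)
    moreover have "(\<Sum>k\<in>J m. (norm (mat_apply (block_ext j B) f k))\<^sup>2) = (\<Sum>q\<in>cube m. (norm (mat_apply (B m) g q))\<^sup>2)"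
    proof -
      have "(\<Sum>k\<in>J m. (norm (mat_apply (block_ext j B) f k))\<^sup>2) = (\<Sum>k\<in>J m. (norm (mat_apply (B m) g (k - j m)))\<^sup>2)"
        by (rule sum.cong[OF refl]) (simp add: inside[OF m] g_def)
      then show ?thesis by (simp add: J_def sum.reindex[OF inj])
    qed
    moreover have "(\<Sum>k\<in>J m. (norm (f k))\<^sup>2) = (\<Sum>q\<in>cube m. (norm (g q))\<^sup>2)"
      by (simp add: J_def sum.reindex[OF inj] g_def)
    ultimately show ?thesis by simp
  qed
  have le: "L2_set (\<lambda>k. norm (mat_apply (block_ext j B) f k)) F \<le> D * ell2_norm f"
    if f: "f \<in> ell2" and F: "finite F" for f F
  proof -
    define h where "h = mat_apply (block_ext j B) f"
    \<comment> \<open>Each index is labelled by its cube. The label 0, free because cubes are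
      numbered from 1, collects the indices in no cube; its class is cut down to \<open>F\<close> to
      stay finite.\<close>
    define \<mu> where "\<mu> = (\<lambda>k. if \<exists>m\<ge>1. k \<in> J m then SOME m. 1 \<le> m \<and> k \<in> J m else 0)"
    define K where "K = (\<lambda>m. if m = 0 then {k \<in> F. \<forall>m\<ge>1. k \<notin> J m} else J m)"
    have \<mu>: "k \<in> K (\<mu> k)" if "k \<in> F" for k
    proof (cases "\<exists>m\<ge>1. k \<in> J m")
      case True
      then have "1 \<le> \<mu> k \<and> k \<in> J (\<mu> k)"
        unfolding \<mu>_def by (simp only: if_True) (rule someI_ex)
      then show ?thesis by (simp add: K_def)
    next
      case False
      then show ?thesis using that by (auto simp: K_def \<mu>_def)
    qed
    \<comment> \<open>The block estimates hold for whole cubes only, so \<open>F\<close> is enlarged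
      by every cube it meets and still remains finite.\<close>
    let ?G = "\<Union>m\<in>\<mu> ` F. K m"
    have finK: "finite (K m)" for m using F finJ by (simp add: K_def)
    have disj: "K m \<inter> K n = {}" if "m \<noteq> n" for m n
      using that disjoint_cubes_unique[OF j, of m n] by (auto simp: K_def memJ)
    have le: "(\<Sum>k\<in>K m. (norm (h k))\<^sup>2) \<le> D\<^sup>2 * (\<Sum>k\<in>K m. (norm (f k))\<^sup>2)" for m
    proof (cases "m = 0")
      case True
      have "h k = f k" if "k \<in> K m" for k
        using that True outside by (simp add: h_def K_def)
      moreover have "1 * (\<Sum>k\<in>K m. (norm (f k))\<^sup>2) \<le> D\<^sup>2 * (\<Sum>k\<in>K m. (norm (f k))\<^sup>2)"
        using D(1) by (intro mult_right_mono sum_nonneg) (auto simp: one_le_power)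
      ultimately show ?thesis by simp
    next
      case False
      then show ?thesis using block[of m f] by (simp add: K_def h_def)
    qed
    have "F \<subseteq> ?G" using \<mu> by blast
    then have "(\<Sum>k\<in>F. (norm (h k))\<^sup>2) \<le> (\<Sum>k\<in>?G. (norm (h k))\<^sup>2)"
      by (rule sum_mono2[rotated]) (use F finK in auto)
    also have "\<dots> = (\<Sum>m\<in>\<mu> ` F. \<Sum>k\<in>K m. (norm (h k))\<^sup>2)"
      by (rule sum.UNION_disjoint) (use F finK disj in auto)
    also have "\<dots> \<le> (\<Sum>m\<in>\<mu> ` F. D\<^sup>2 * (\<Sum>k\<in>K m. (norm (f k))\<^sup>2))"
      by (rule sum_mono) (rule le)
    also have "\<dots> = D\<^sup>2 * (\<Sum>m\<in>\<mu> ` F. \<Sum>k\<in>K m. (norm (f k))\<^sup>2)"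
      by (simp only: sum_distrib_left)
    also have "(\<Sum>m\<in>\<mu> ` F. \<Sum>k\<in>K m. (norm (f k))\<^sup>2) = (\<Sum>k\<in>?G. (norm (f k))\<^sup>2)"
      by (rule sum.UNION_disjoint[symmetric]) (use F finK disj in auto)
    finally have "sqrt (\<Sum>k\<in>F. (norm (h k))\<^sup>2) \<le> sqrt (D\<^sup>2 * (\<Sum>k\<in>?G. (norm (f k))\<^sup>2))"
      by (rule real_sqrt_le_mono)
    then have "L2_set (\<lambda>k. norm (h k)) F \<le> D * L2_set (\<lambda>k. norm (f k)) ?G"
      using D(1) by (simp add: L2_set_def real_sqrt_mult)
    also have "\<dots> \<le> D * ell2_norm f"
      using D(1) F finK by (intro mult_left_mono L2_set_le_ell2_norm[OF f]) auto
    finally show ?thesis by (simp add: h_def)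
  qed
  show ?thesis
    unfolding bounded_mats_def mem_Collect_eq
  proof (intro conjI ballI allI exI)
    fix f :: "'d zvec" and k assume f: "f \<in> ell2"
    show "(\<lambda>l. block_ext j B k l * f l) summable_on UNIV"
    proof (cases "\<exists>m\<ge>1. k - j m \<in> cube m")
      case True
      then obtain m where m: "1 \<le> m" "k - j m \<in> cube m" by blast
      show ?thesis
        by (rule infsum_finite_support[OF finJ[of m]])
           (simp add: block_ext_inside[OF j m] embed_def memJ)
    next
      case False
      show ?thesis
        by (rule infsum_finite_support[of "{k}"])
           (use False in \<open>auto simp: block_ext_outside mat_id_def\<close>)
    qed
    show "mat_apply (block_ext j B) f \<in> ell2" by (rule ell2I[OF le[OF f]])
    show "ell2_norm (mat_apply (block_ext j B) f) \<le> D * ell2_norm f" by (rule ell2_norm_le[OF le[OF f]])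
  qed
qed

text \<open>The identities hold block by block; the common bound \<open>C\<close> on the
  \<open>op_norm (X m)\<close> is what makes the glued inverse a bounded matrix.\<close>

lemma block_ext_inverse:
  assumes j: "disjoint_cubes j" and X: "\<And>m. 1 \<le> m \<Longrightarrow> is_fin_inverse m (B m) (X m)"
    and B: "\<And>m. 1 \<le> m \<Longrightarrow> fin_mat m (B m)" and C: "\<And>m. 1 \<le> m \<Longrightarrow> op_norm (X m) \<le> C"
  shows "is_l2_inverse (block_ext j B) (block_ext j X)"
proof -
  have Xf: "fin_mat m (X m)" if "1 \<le> m" for m using X[OF that] by (simp add: is_fin_inverse_def)
  have "mat_mult (block_ext j B) (block_ext j X) = block_ext j cube_proj"
    by (subst block_ext_mult[OF j B Xf]) (use X in \<open>auto simp: is_fin_inverse_def intro: block_ext_cong\<close>)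
  moreover have "mat_mult (block_ext j X) (block_ext j B) = block_ext j cube_proj"
    by (subst block_ext_mult[OF j Xf B]) (use X in \<open>auto simp: is_fin_inverse_def intro: block_ext_cong\<close>)
  moreover have "block_ext j X \<in> bounded_mats"
  proof (rule block_ext_bounded[OF j Xf])
    fix m :: nat and f :: "'a zvec" assume m: "1 \<le> m" and f: "f \<in> ell2"
    have "ell2_norm (mat_apply (X m) f) \<le> op_norm (X m) * ell2_norm f"
      by (rule op_norm_bound[OF fin_mat_bounded[OF Xf[OF m]] f])
    also have "\<dots> \<le> C * ell2_norm f" by (rule mult_right_mono[OF C[OF m] ell2_norm_nonneg])
    finally show "ell2_norm (mat_apply (X m) f) \<le> C * ell2_norm f" .
  qed
  ultimately show ?thesis using block_ext_id by (simp add: is_l2_inverse_def)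
qed

text \<open>Multiplying from the left selects the rows of one cube, and in these rows the completed
  matrix has only its block. A single projection thus suffices, and its norm is paid once.\<close>

lemma block_compress:
  assumes j: "disjoint_cubes j" and m: "1 \<le> m"
  shows "mat_mult (embed m (j m) (cube_proj m)) (block_ext j X) = embed m (j m) (X m)"
proof (intro ext)
  fix k l
  have "mat_mult (embed m (j m) (cube_proj m)) (block_ext j X) k l =
      (\<Sum>p\<in>{k}. embed m (j m) (cube_proj m) k p * block_ext j X p l)"
    unfolding mat_mult_def by (rule infsum_finite_support) (auto simp: embed_def cube_proj_def)
  then show "mat_mult (embed m (j m) (cube_proj m)) (block_ext j X) k l = embed m (j m) (X m) k l"
    using block_ext_inside[OF j m, of k X l]
    by (cases "k - j m \<in> cube m") (simp_all add: embed_def cube_proj_def)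
qed

section \<open>Gluing inside the algebra\<close>

context matrix_banach_algebra
begin

text \<open>Outside the algebra the extended norm is infinite, and since \<open>C > 0\<close> the
  first inequality of (C3) would make the supremum infinite.\<close>

lemma block_mat_closed:
  assumes eq: "block_norm_equivalence \<A> nrm j" and B: "B \<in> finite_mat_seqs \<A> nrm"
  shows "block_mat j B \<in> \<A>"
proof (rule ccontr)
  assume n: "block_mat j B \<notin> \<A>"
  obtain C :: real where C: "C > 0"
      "ennreal C * ext_norm \<A> nrm (block_mat j B) \<le> (SUP m\<in>{1..}. ext_norm \<A> nrm (B m))"
    using eq B unfolding block_norm_equivalence_def by blast
  have "(SUP m\<in>{1..}. ext_norm \<A> nrm (B m)) < \<infinity>" using B by (simp add: finite_mat_seqs_def)
  with C(2) have "ennreal C * \<infinity> < \<infinity>" using n by (simp add: ext_norm_def)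
  then show False using C(1) by (simp add: ennreal_mult_top)
qed

lemma finite_mat_seqs_inverse_closed:
  assumes trans: "translation_invariant \<A> nrm" and solid: "weakly_solid \<A> nrm"
    and j: "disjoint_cubes j" and eq: "block_norm_equivalence \<A> nrm j"
    and inv: "inverse_closed \<A>"
  shows "seqs_inverse_closed \<A> nrm (finite_mat_seqs \<A> nrm)"
  unfolding seqs_inverse_closed_def
proof (intro ballI allI impI)
  fix B X and C :: real
  assume B: "B \<in> finite_mat_seqs \<A> nrm" and H: "\<forall>n\<ge>1. is_fin_inverse n (B n) (X n) \<and>
      ext_norm \<A> nrm (B n) \<le> ennreal C \<and> op_norm (X n) \<le> C"
  obtain K where K: "0 \<le> K" "\<And>n. 1 \<le> n \<Longrightarrow> ext_norm \<A> nrm (cube_proj n) \<le> ennreal K"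
    using weakly_solid_bound[OF solid id_closed nrm_nonneg[OF id_closed]]
    unfolding finite_section_id by blast
  \<comment> \<open>Needed for the completing term of \<open>block_ext\<close>: the projections
    themselves are glued as a sequence of bounded norm.\<close>
  have "block_mat j cube_proj \<in> \<A>"
    by (rule block_mat_closed[OF eq finite_mat_seqsI[OF fin_mat_cube_proj K(2)]])
  then have "block_ext j B \<in> \<A>"
    unfolding block_ext_def by (intro add_closed diff_closed id_closed block_mat_closed[OF eq B])
  moreover have "is_l2_inverse (block_ext j B) (block_ext j X)"
    by (rule block_ext_inverse[OF j, where C = C]) (use H B in \<open>auto simp: finite_mat_seqs_def\<close>)
  ultimately have XA: "block_ext j X \<in> \<A>" using inv unfolding inverse_closed_def by blast
  \<comment> \<open>\<open>nrm (block_ext j X)\<close> is a single number, so the bound is the same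
    for all \<open>m\<close>. Translation moves the projection out to the cube at \<open>j m\<close>
    and the block back to the origin without changing norms.\<close>
  have "ext_norm \<A> nrm (X m) \<le> ennreal (K * nrm (block_ext j X))" if m: "1 \<le> m" for m
  proof -
    have Xf: "fin_mat m (X m)" using H m by (simp add: is_fin_inverse_def)
    let ?Q = "embed m (j m) (cube_proj m)" and ?Y = "embed m (j m) (X m)"
    have P: "cube_proj m \<in> \<A>" "nrm (cube_proj m) \<le> K"
      using K(1) K(2)[OF m] by (simp_all add: ext_norm_le_iff)
    have Qs: "?Q = (\<lambda>k l. cube_proj m (k + - j m) (l + - j m))"
      by (simp add: embed_fin_mat[OF fin_mat_cube_proj])
    have Q: "?Q \<in> \<A>" "nrm ?Q \<le> K"
      unfolding Qs using translate_closed[OF trans P(1), of "- j m"]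
        nrm_translate[OF trans P(1), of "- j m"] P(2) by simp_all
    have Y: "?Y \<in> \<A>" and "nrm ?Y \<le> nrm ?Q * nrm (block_ext j X)"
      using mult_closed[OF Q(1) XA] nrm_mult[OF Q(1) XA] by (simp_all only: block_compress[OF j m])
    note this(2)
    also have "\<dots> \<le> K * nrm (block_ext j X)" by (rule mult_right_mono[OF Q(2) nrm_nonneg[OF XA]])
    finally have nY: "nrm ?Y \<le> K * nrm (block_ext j X)" .
    have "X m = (\<lambda>k l. ?Y (k + j m) (l + j m))" by (simp add: embed_fin_mat[OF Xf])
    then have "X m \<in> \<A>" "nrm (X m) = nrm ?Y"
      using translate_closed[OF trans Y, of "j m"] nrm_translate[OF trans Y, of "j m"] by simp_all
    then show ?thesis using nY by (simp add: ext_norm_le_iff)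
  qed
  then show "\<exists>C'. \<forall>n\<ge>1. ext_norm \<A> nrm (X n) \<le> ennreal C'" by blast
qed

end

theorem theorem6:
  fixes \<A> :: "('d::finite) zmat set"
    and nrm :: "'d zmat \<Rightarrow> real"
    and j :: "nat \<Rightarrow> int ^ 'd"
  assumes "matrix_banach_algebra \<A> nrm"
    and "star_closed \<A>"
    and "translation_invariant \<A> nrm"
    and "weakly_solid \<A> nrm"
    and "weakly_inverse_closed \<A> nrm"
    and "disjoint_cubes j"
    and "block_norm_equivalence \<A> nrm j"
  shows "(inverse_closed \<A> \<longleftrightarrow> seqs_inverse_closed \<A> nrm (section_seqs \<A>)) \<and>
         (seqs_inverse_closed \<A> nrm (section_seqs \<A>) \<longleftrightarrow>
          seqs_inverse_closed \<A> nrm (finite_mat_seqs \<A> nrm))"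
  using matrix_banach_algebra.inverse_closed_if_section_seqs[OF assms(1,2,4,5)]
    matrix_banach_algebra.finite_mat_seqs_inverse_closed[OF assms(1,3,4,6,7)]
    section_seqs_inverse_closed[of \<A> nrm] by blast

end
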